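(* Let $f\in h^1$ and let $C$ be any convex curve in $\mathbb{D}$. Then, for $0<p<1$, $$\int_C |f(z)|^p\,|dz|\le A(p)\left(\int_{\mathbb{T}}|f(z)|\,|dz|\right)^p,$$ where $$A(p)=2(2\pi)^{1-p}\left[1+\sec\left(\frac{\pi p}{2}\right)\right].$$
   Context: $\mathbb{D}=\{z\in\mathbb{C}:|z|<1\}$ and $\mathbb{T}=\{z\in\mathbb{C}:|z|=1\}$. A complex-valued function $f=u+iv$ is harmonic in $\mathbb{D}$ if $u,v$ are real-valued harmonic functions in $\mathbb{D}$. $h^1$ is the set of complex-valued harmonic functions $f$ in $\mathbb{D}$ with $\sup_{0<r<1}\frac{1}{2\pi}\int_0^{2\pi}|f(re^{i\theta})|\,d\theta<\infty$. On $\mathbb{T}$, $f(e^{i\theta})$ denotes the radial limit $\lim_{r\to1^-}f(re^{i\theta})$ (existing for almost every $\theta$), and $\int_{\mathbb{T}}|f(z)|\,|dz|=\int_0^{2\pi}|f(e^{i\theta})|\,d\theta$. A convex curve in $\mathbb{D}$ is a curve contained in $\mathbb{D}$, traversed once, that is the boundary of a bounded convex set or an arc of such a boundary; line segments (e.g. the diameter $-1<x<1$) are included. $|dz|$ is arc length.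
   Formalization: As printed the bound fails for the Poisson kernel (radial limits 0 a.e.); it is proved for all f in h^1 with 2π times the h^1 norm in place of the integral over T, and as printed when f is the Poisson integral of its radial limits. *)

theory Defs
  imports "HOL-Analysis.Analysis"
begin

definition real_harmonic_on :: "(complex \<Rightarrow> real) \<Rightarrow> complex set \<Rightarrow> bool" where
  "real_harmonic_on u S \<longleftrightarrow>
     (\<exists>ux uy uxx uxy uyx uyy.
        continuous_on S uxx \<and> continuous_on S uxy \<and>
        continuous_on S uyx \<and> continuous_on S uyy \<and>
        (\<forall>z\<in>S.
           (u has_derivative (\<lambda>h. ux z * Re h + uy z * Im h)) (at z) \<and>
           (ux has_derivative (\<lambda>h. uxx z * Re h + uxy z * Im h)) (at z) \<and>
           (uy has_derivative (\<lambda>h. uyx z * Re h + uyy z * Im h)) (at z) \<and>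
           uxx z + uyy z = 0))"

definition harmonic_on :: "(complex \<Rightarrow> complex) \<Rightarrow> complex set \<Rightarrow> bool" where
  "harmonic_on f S \<longleftrightarrow>
     real_harmonic_on (\<lambda>z. Re (f z)) S \<and> real_harmonic_on (\<lambda>z. Im (f z)) S"

definition circle_mean :: "(complex \<Rightarrow> complex) \<Rightarrow> real \<Rightarrow> real" where
  "circle_mean f r = 1 / (2 * pi) * (LBINT \<theta>:{0..2*pi}. norm (f (of_real r * cis \<theta>)))"

definition h1 :: "(complex \<Rightarrow> complex) set" where
  "h1 = {f. harmonic_on f (ball 0 1) \<and> bdd_above (circle_mean f ` {0<..<1})}"

definition h1_norm :: "(complex \<Rightarrow> complex) \<Rightarrow> real" where
  "h1_norm f = (SUP r\<in>{0<..<1}. circle_mean f r)"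

definition radial_limit :: "(complex \<Rightarrow> complex) \<Rightarrow> real \<Rightarrow> complex" where
  "radial_limit f \<theta> = Lim (at_left 1) (\<lambda>r. f (of_real r * cis \<theta>))"

definition boundary_integral :: "(complex \<Rightarrow> complex) \<Rightarrow> real" where
  "boundary_integral f = (LBINT \<theta>:{0..2*pi}. norm (radial_limit f \<theta>))"

text \<open>
  For a function in \<open>h1\<close> the number \<open>2 * pi * h1_norm f\<close> is the total mass on the unit circle
  of the boundary measure of \<open>f\<close>. It can exceed \<open>boundary_integral f\<close>: the Poisson kernel
  \<open>z \<mapsto> (1 - |z|^2) / |1 - z|^2\<close> has \<open>h1_norm\<close> equal to 1, while its radial limits vanish
  almost everywhere. The two numbers agree when the boundary measure is absolutely continuous,
  that is, when \<open>f\<close> is the Poisson integral of its radial limits.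
\<close>

definition poisson_integral_of_radial_limits :: "(complex \<Rightarrow> complex) \<Rightarrow> bool" where
  "poisson_integral_of_radial_limits f \<longleftrightarrow>
     set_integrable lborel {0..2*pi} (radial_limit f) \<and>
     (\<forall>z\<in>ball 0 1.
        f z = 1 / (2 * pi) *
          (LBINT \<theta>:{0..2*pi}.
             of_real ((1 - (norm z)\<^sup>2) / (norm (cis \<theta> - z))\<^sup>2) * radial_limit f \<theta>))"

definition curve_length :: "(real \<Rightarrow> complex) \<Rightarrow> real \<Rightarrow> real \<Rightarrow> ennreal" where
  "curve_length \<gamma> a b =
     (SUP xs\<in>{xs. sorted xs \<and> set xs \<subseteq> {a..b}}.
        ennreal (\<Sum>i<length xs - 1. dist (\<gamma> (xs ! i)) (\<gamma> (xs ! Suc i))))"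

definition arc_length_parametrized :: "(real \<Rightarrow> complex) \<Rightarrow> real set \<Rightarrow> bool" where
  "arc_length_parametrized \<gamma> I \<longleftrightarrow>
     (\<forall>s\<in>I. \<forall>t\<in>I. s \<le> t \<longrightarrow> curve_length \<gamma> s t = ennreal (t - s))"

definition traversed_once :: "(real \<Rightarrow> complex) \<Rightarrow> real set \<Rightarrow> bool" where
  "traversed_once \<gamma> I \<longleftrightarrow>
     inj_on \<gamma> I \<or> (\<exists>a b. I = {a..b} \<and> \<gamma> a = \<gamma> b \<and> inj_on \<gamma> {a..<b})"

text \<open>
  Convex curves are rectifiable, so parametrizing them by arc length loses no generality; it also
  makes \<open>\<gamma>\<close> continuous on \<open>I\<close>. The interval \<open>I\<close> need not be closed: the diameter
  \<open>-1 < x < 1\<close> is \<open>of_real\<close> on \<open>{-1<..<1}\<close>. The convex set \<open>K\<close> may have empty interior, in which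
  case its frontier is a line segment (or a point). Only the curve, not \<open>K\<close>, will be required
  to lie in the unit disc.
\<close>

definition convex_curve :: "(real \<Rightarrow> complex) \<Rightarrow> real set \<Rightarrow> bool" where
  "convex_curve \<gamma> I \<longleftrightarrow>
     is_interval I \<and> arc_length_parametrized \<gamma> I \<and> traversed_once \<gamma> I \<and>
     (\<exists>K. convex K \<and> bounded K \<and> \<gamma> ` I \<subseteq> frontier K)"

definition arc_length_integral :: "(real \<Rightarrow> complex) \<Rightarrow> real set \<Rightarrow> (complex \<Rightarrow> real) \<Rightarrow> ennreal" where
  "arc_length_integral \<gamma> I g = (\<integral>\<^sup>+s\<in>I. ennreal (g (\<gamma> s)) \<partial>lborel)"

definition A_const :: "real \<Rightarrow> real" where
  "A_const p = 2 * (2 * pi) powr (1 - p) * (1 + 1 / cos (pi * p / 2))"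

end

theory Submission
  imports Defs "HOL-Complex_Analysis.Complex_Analysis" "HOL-Real_Asymp.Real_Asymp"
begin

text \<open>
  For \<open>r < 1\<close> the dilate \<open>f (r z)\<close> is dominated by a positive harmonic function with value
  \<open>circle_mean f r\<close> at \<open>0\<close>, hence by \<open>\<bar>F\<bar>\<close> for a holomorphic \<open>F\<close> with positive real part
  (Herglotz). The integral of \<open>\<bar>F\<bar>\<^sup>p\<close> over the circle is at most
  \<open>2 \<pi> sec (\<pi> p / 2) (Re (F 0))\<^sup>p\<close>, because \<open>\<bar>F\<^sup>p\<bar> cos (\<pi> p / 2) \<le> Re (F\<^sup>p)\<close>
  (Kolmogorov).

  It remains to pass from the circle to a convex curve, at the cost of a factor 2 (Gabriel).
  The Poisson inequality for the product of a holomorphic \<open>h\<close> and a quadratic polynomial bounds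
  the integral of \<open>\<bar>h\<bar>\<close> over a segment by the integral over the circle of \<open>\<bar>h w\<bar> / \<pi>\<close> times the
  angle under which the segment is seen from \<open>w\<close>. Almost every line through \<open>w\<close> meets a convex
  curve at most twice, so the angles belonging to a polygon inscribed in the curve add up to at
  most \<open>2 \<pi>\<close>.
\<close>

subsection \<open>Harmonic functions as real parts\<close>

text \<open>For p < 1 and harmonic f the function |f|^p is in general not subharmonic, so no Poisson
  inequality applies to it directly. The exponent is therefore absorbed before the curve is touched:
  a holomorphic \<open>F\<close> with positive real part has no zeros, its p-th power is again
  holomorphic with modulus |F|^p, and the passage from the circle to the curve is required for
  exponent 1 only.

  The factor 2 of that passage is 2 pi / pi. From a point of the unit circle the disc is seen within
  an angle pi, and a direction hit at most twice by the curve contributes twice to the total change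
  of angle. For each such point at most two directions can be hit three times, because the line in
  such a direction supports the convex set. This argument uses supporting lines only, so the convex
  set may leave the disc or have empty interior.

  With N the value of the majorant at 0, the two steps give 2 * 2 pi sec(pi p / 2) N^p; here N is a
  circle mean of |f|, up to an arbitrarily small error.\<close>

lemma second_difference_mvt:
  fixes u :: "complex \<Rightarrow> real"
  assumes S: "\<And>s t. 0 \<le> s \<Longrightarrow> s \<le> 1 \<Longrightarrow> 0 \<le> t \<Longrightarrow> t \<le> 1 \<Longrightarrow> z + of_real s * a + of_real t * b \<in> S"
    and u': "\<And>w. w \<in> S \<Longrightarrow> (u has_derivative u' w) (at w)"
    and u2: "\<And>w. w \<in> S \<Longrightarrow> ((\<lambda>w. u' w b) has_derivative u2 w) (at w)"
  obtains s t where "0 < s" "s < 1" "0 < t" "t < 1"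
    "u (z + a + b) - u (z + a) - u (z + b) + u z = u2 (z + of_real s * a + of_real t * b) a"
proof -
  \<comment> \<open>\<open>G 1 - G 0\<close> is the second difference. The mean value theorem in
    \<open>t\<close>, and again in \<open>s\<close>, turns it into a second derivative at an
    interior point of the parallelogram.\<close>
  define G where "G t = u (z + a + of_real t * b) - u (z + of_real t * b)" for t :: real
  have dG: "(G has_real_derivative (u' (z + a + of_real t * b) b - u' (z + of_real t * b) b)) (at t)"
    if "0 \<le> t" "t \<le> 1" for t
  proof -
    have m: "z + a + of_real t * b \<in> S" "z + of_real t * b \<in> S"
      using S[of 1 t] S[of 0 t] that by auto
    have l: "((\<lambda>t. z + a + of_real t * b) has_derivative (\<lambda>h. of_real h * b)) (at t)"
      "((\<lambda>t. z + of_real t * b) has_derivative (\<lambda>h. of_real h * b)) (at t)"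
      by (auto intro!: derivative_eq_intros)
    have lin: "u' w (of_real h * b) = h * u' w b" if "w \<in> S" for w h
      using linear_scale[OF has_derivative_linear[OF u'[OF that]], of h b]
      by (simp add: scaleR_conv_of_real)
    show ?thesis
      unfolding G_def has_field_derivative_def
      by (rule has_derivative_eq_rhs,
          rule has_derivative_diff[OF has_derivative_compose[OF l(1) u'[OF m(1)]]
            has_derivative_compose[OF l(2) u'[OF m(2)]]])
        (simp only: fun_eq_iff lin[OF m(1)] lin[OF m(2)] left_diff_distrib mult.commute[of _ "of_real _"], simp add: algebra_simps)
  qed
  obtain t where t: "0 < t" "t < 1"
    "G 1 - G 0 = (1 - 0) * (u' (z + a + of_real t * b) b - u' (z + of_real t * b) b)"
    using MVT2[OF zero_less_one dG] by blast
  define K where "K s = u' (z + of_real s * a + of_real t * b) b" for s :: real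
  have dK: "(K has_real_derivative (u2 (z + of_real s * a + of_real t * b) a)) (at s)"
    if "0 \<le> s" "s \<le> 1" for s
  proof -
    have m: "z + of_real s * a + of_real t * b \<in> S" using S that t by auto
    have l: "((\<lambda>s. z + of_real s * a + of_real t * b) has_derivative (\<lambda>h. of_real h * a)) (at s)"
      by (auto intro!: derivative_eq_intros)
    have lin: "u2 w (of_real h * a) = h * u2 w a" if "w \<in> S" for w h
      using linear_scale[OF has_derivative_linear[OF u2[OF that]], of h a]
      by (simp add: scaleR_conv_of_real)
    show ?thesis
      unfolding K_def has_field_derivative_def
      by (rule has_derivative_eq_rhs, rule has_derivative_compose[OF l u2[OF m]])
        (simp only: fun_eq_iff lin[OF m], simp add: mult.commute)
  qed
  obtain s where s: "0 < s" "s < 1"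
    "K 1 - K 0 = (1 - 0) * u2 (z + of_real s * a + of_real t * b) a"
    using MVT2[OF zero_less_one dK] by blast
  show ?thesis
    by (rule that[OF s(1,2) t(1,2)]) (use s(3) t(3) in \<open>simp add: G_def K_def\<close>)
qed

text \<open>\<open>real_harmonic_on\<close> keeps \<open>uxy\<close> and \<open>uyx\<close> apart,
  whereas the Cauchy-Riemann equations for \<open>ux - i uy\<close> ask for their equality. The
  second difference over a square of side h is h^2 times a value of \<open>uyx\<close> and also h^2
  times a value of \<open>uxy\<close>, both taken at points that tend to \<open>z\<close> with
  h.\<close>

lemma mixed_partials_commute:
  fixes u :: "complex \<Rightarrow> real"
  assumes S: "open S" "z \<in> S"
    and c: "continuous_on S uxy" "continuous_on S uyx"
    and du: "\<And>w. w \<in> S \<Longrightarrow> (u has_derivative (\<lambda>h. ux w * Re h + uy w * Im h)) (at w)"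
    and dx: "\<And>w. w \<in> S \<Longrightarrow> (ux has_derivative (\<lambda>h. uxx w * Re h + uxy w * Im h)) (at w)"
    and dy: "\<And>w. w \<in> S \<Longrightarrow> (uy has_derivative (\<lambda>h. uyx w * Re h + uyy w * Im h)) (at w)"
  shows "uxy z = uyx z"
proof -
  obtain r where r: "r > 0" "ball z r \<subseteq> S" using S openE by blast
  have ex: "\<exists>p q. dist p z \<le> 2 * h \<and> dist q z \<le> 2 * h \<and> uxy p = uyx q"
    if h: "0 < h" "2 * h < r" for h
  proof -
    have nrm: "norm (of_real s * w + of_real t * w') \<le> 2 * h"
      if "0 \<le> s" "s \<le> 1" "0 \<le> t" "t \<le> 1" "norm w = h" "norm w' = h" for s t and w w' :: complex
    proof -
      have "norm (of_real s * w + of_real t * w') \<le> s * h + t * h"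
        using that norm_triangle_ineq[of "of_real s * w" "of_real t * w'"] by (simp add: norm_mult)
      also have "\<dots> \<le> 1 * h + 1 * h"
        using that h by (intro add_mono mult_right_mono) auto
      finally show ?thesis by simp
    qed
    have in1: "z + of_real s * w + of_real t * w' \<in> S"
      if "0 \<le> s" "s \<le> 1" "0 \<le> t" "t \<le> 1" "norm w = h" "norm w' = h" for s t and w w' :: complex
    proof -
      have "dist z (z + of_real s * w + of_real t * w') \<le> 2 * h"
        using nrm[OF that] by (simp add: dist_norm norm_minus_commute algebra_simps)
      then show ?thesis using r h by (auto simp: subset_iff)
    qed
    have nh: "norm (of_real h :: complex) = h" "norm (\<i> * of_real h) = h"
      using h by (auto simp: norm_mult)
    obtain s t where 1: "0 < s" "s < 1" "0 < t" "t < 1"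
      "u (z + of_real h + \<i> * of_real h) - u (z + of_real h) - u (z + \<i> * of_real h) + u z
        = h * uyx (z + of_real s * of_real h + of_real t * (\<i> * of_real h)) * h"
    proof (rule second_difference_mvt[of z "of_real h" "\<i> * of_real h" S u
          "\<lambda>w h. ux w * Re h + uy w * Im h" "\<lambda>w k. h * (uyx w * Re k + uyy w * Im k)"])
      fix w assume w: "w \<in> S"
      show "((\<lambda>w. ux w * Re (\<i> * of_real h) + uy w * Im (\<i> * of_real h)) has_derivative
          (\<lambda>k. h * (uyx w * Re k + uyy w * Im k))) (at w)"
        using has_derivative_mult_right[OF dy[OF w], of h] by (simp add: mult.commute)
    qed (use in1 nh du in auto)
    obtain s' t' where 2: "0 < s'" "s' < 1" "0 < t'" "t' < 1"
      "u (z + \<i> * of_real h + of_real h) - u (z + \<i> * of_real h) - u (z + of_real h) + u z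
        = h * uxy (z + of_real s' * (\<i> * of_real h) + of_real t' * of_real h) * h"
    proof (rule second_difference_mvt[of z "\<i> * of_real h" "of_real h" S u
          "\<lambda>w h. ux w * Re h + uy w * Im h" "\<lambda>w k. h * (uxx w * Re k + uxy w * Im k)"])
      fix w assume w: "w \<in> S"
      show "((\<lambda>w. ux w * Re (of_real h) + uy w * Im (of_real h)) has_derivative
          (\<lambda>k. h * (uxx w * Re k + uxy w * Im k))) (at w)"
        using has_derivative_mult_right[OF dx[OF w], of h] by (simp add: mult.commute)
    qed (use in1 nh du in auto)
    let ?q = "z + of_real s * of_real h + of_real t * (\<i> * of_real h)"
    let ?p = "z + of_real s' * (\<i> * of_real h) + of_real t' * of_real h"
    have "h * uxy ?p * h = h * uyx ?q * h"
      using 1(5) 2(5) unfolding add.assoc add.commute[of "of_real h" "\<i> * of_real h"] by linarith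
    then have "h * (h * uxy ?p) = h * (h * uyx ?q)" by (simp only: mult_ac)
    then have "uxy ?p = uyx ?q" using h by (simp only: mult_cancel_left) auto
    moreover have "dist ?p z \<le> 2 * h" "dist ?q z \<le> 2 * h"
      using nrm[of s t "of_real h" "\<i> * of_real h"] nrm[of s' t' "\<i> * of_real h" "of_real h"] 1 2 nh
      by (auto simp: dist_norm add.assoc)
    ultimately show ?thesis by blast
  qed
  \<comment> \<open>The intermediate points are within \<open>2 * h n\<close> of \<open>z\<close>;
    the factor 1/4 keeps this below \<open>r\<close> already for n = 0.\<close>
  define h where "h n = r / 4 / real (Suc n)" for n
  have h: "0 < h n" "2 * h n < r" for n
  proof -
    show "0 < h n" using r by (simp add: h_def)
    have "h n \<le> r / 4" using r by (simp add: h_def field_simps)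
    then show "2 * h n < r" using r by simp
  qed
  obtain p q where pq: "\<And>n. dist (p n) z \<le> 2 * h n" "\<And>n. dist (q n) z \<le> 2 * h n"
    "\<And>n. uxy (p n) = uyx (q n)"
    using ex[OF h] by metis
  have h0: "(\<lambda>n. 2 * h n) \<longlonglongrightarrow> 0"
    unfolding h_def divide_inverse[of _ "real (Suc _)"]
    by (intro tendsto_mult_right_zero LIMSEQ_inverse_real_of_nat)
  have lim: "p \<longlonglongrightarrow> z" "q \<longlonglongrightarrow> z"
    by (rule tendsto_dist_iff[THEN iffD2],
        rule tendsto_sandwich[OF _ _ tendsto_const h0]; simp add: pq)+
  have "isCont uxy z" "isCont uyx z"
    using c S by (auto simp: continuous_on_eq_continuous_at)
  then have "(\<lambda>n. uxy (p n)) \<longlonglongrightarrow> uxy z" "(\<lambda>n. uyx (q n)) \<longlonglongrightarrow> uyx z"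
    using lim isCont_tendsto_compose by blast+
  then show ?thesis using pq(3) LIMSEQ_unique by simp
qed

text \<open>The function \<open>G = ux - i uy\<close> is holomorphic: its Cauchy-Riemann equations
  are \<open>uxx + uyy = 0\<close> and \<open>uxy = uyx\<close>. Convexity of \<open>S\<close> gives
  a primitive \<open>F\<close> of \<open>G\<close>, and \<open>u - Re F\<close> has derivative 0, so
  it is a constant that can be added to \<open>F\<close>.\<close>

lemma real_harmonic_on_imp_Re_holomorphic:
  assumes u: "real_harmonic_on u S" and S: "open S" "convex S"
  obtains \<Phi> where "\<Phi> holomorphic_on S" "\<And>z. z \<in> S \<Longrightarrow> u z = Re (\<Phi> z)"
proof -
  from u have "\<exists>ux uy uxx uxy uyx uyy. continuous_on S uxx \<and> continuous_on S uxy \<and>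
      continuous_on S uyx \<and> continuous_on S uyy \<and>
      (\<forall>z\<in>S. (u has_derivative (\<lambda>h. ux z * Re h + uy z * Im h)) (at z) \<and>
         (ux has_derivative (\<lambda>h. uxx z * Re h + uxy z * Im h)) (at z) \<and>
         (uy has_derivative (\<lambda>h. uyx z * Re h + uyy z * Im h)) (at z) \<and>
         uxx z + uyy z = 0)" by (simp only: real_harmonic_on_def)
  then obtain ux uy uxx uxy uyx uyy where *: "continuous_on S uxx \<and> continuous_on S uxy \<and>
      continuous_on S uyx \<and> continuous_on S uyy \<and>
      (\<forall>z\<in>S. (u has_derivative (\<lambda>h. ux z * Re h + uy z * Im h)) (at z) \<and>
         (ux has_derivative (\<lambda>h. uxx z * Re h + uxy z * Im h)) (at z) \<and>
         (uy has_derivative (\<lambda>h. uyx z * Re h + uyy z * Im h)) (at z) \<and>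
         uxx z + uyy z = 0)" by (elim exE)
  have c: "continuous_on S uxy" "continuous_on S uyx"
    using * by blast+
   have  du: "\<And>w. w \<in> S \<Longrightarrow> (u has_derivative (\<lambda>h. ux w * Re h + uy w * Im h)) (at w)"
    and dx: "\<And>w. w \<in> S \<Longrightarrow> (ux has_derivative (\<lambda>h. uxx w * Re h + uxy w * Im h)) (at w)"
    and dy: "\<And>w. w \<in> S \<Longrightarrow> (uy has_derivative (\<lambda>h. uyx w * Re h + uyy w * Im h)) (at w)"
    and lap: "\<And>w. w \<in> S \<Longrightarrow> uxx w + uyy w = 0"
    using * by simp_all
  define G where "G w = Complex (ux w) (- uy w)" for w
  have G: "(G has_field_derivative Complex (uxx w) (- uxy w)) (at w)" if w: "w \<in> S" for w
  proof -
    have sym: "uxy w = uyx w"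
      by (rule mixed_partials_commute[OF S(1) w c du dx dy])
    have "(G has_derivative (\<lambda>h. of_real (uxx w * Re h + uxy w * Im h) +
       \<i> * of_real (- (uyx w * Re h + uyy w * Im h)))) (at w)"
      unfolding G_def Complex_eq
      by (rule has_derivative_add[OF has_derivative_of_real[OF dx[OF w]]
            has_derivative_mult_right[OF has_derivative_of_real[OF has_derivative_minus[OF dy[OF w]]]]])
    moreover have "(\<lambda>h. of_real (uxx w * Re h + uxy w * Im h) +
       \<i> * of_real (- (uyx w * Re h + uyy w * Im h))) = (*) (Complex (uxx w) (- uxy w))"
    proof (rule ext, rule complex_eqI)
      fix h
      have "uyy w = - uxx w" using lap[OF w] by linarith
      then show "Im (of_real (uxx w * Re h + uxy w * Im h) +
          \<i> * of_real (- (uyx w * Re h + uyy w * Im h))) = Im (Complex (uxx w) (- uxy w) * h)"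
        by (simp add: sym)
    qed simp
    ultimately show ?thesis by (simp add: has_field_derivative_def)
  qed
  have holG: "G holomorphic_on S"
    using G unfolding holomorphic_on_open[OF S(1)] by blast
  obtain F where F: "\<And>x. x \<in> S \<Longrightarrow> (F has_field_derivative G x) (at x within S)"
    using holomorphic_convex_primitive'[OF S(2,1) holG] by blast
  then have F': "\<And>x. x \<in> S \<Longrightarrow> (F has_field_derivative G x) (at x)"
    by (simp add: at_within_open[OF _ S(1)])
  have *: "((\<lambda>w. u w - Re (F w)) has_derivative (\<lambda>h. 0)) (at w within S)" if w: "w \<in> S" for w
  proof -
    have "((\<lambda>w. u w - Re (F w)) has_derivative
      (\<lambda>h. (ux w * Re h + uy w * Im h) - Re (G w * h))) (at w)"
      by (rule has_derivative_diff[OF du[OF w]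
            has_derivative_Re[OF F'[OF w, unfolded has_field_derivative_def]]])
    then have "((\<lambda>w. u w - Re (F w)) has_derivative (\<lambda>h. 0)) (at w)"
      by (simp add: G_def)
    then show ?thesis by (rule has_derivative_at_withinI)
  qed
  have "\<exists>k. \<forall>w\<in>S. u w - Re (F w) = k"
    by (rule has_derivative_zero_constant[OF S(2) *, simplified])
  then obtain k where k: "\<And>w. w \<in> S \<Longrightarrow> u w - Re (F w) = k"
    by auto
  have holF: "F holomorphic_on S"
    using F' unfolding holomorphic_on_open[OF S(1)] by blast
  show ?thesis
  proof
    show "(\<lambda>z. F z + of_real k) holomorphic_on S"
      by (intro holomorphic_intros holF)
    show "u z = Re (F z + of_real k)" if "z \<in> S" for z
      using k[OF that] by simp
  qed
qed

subsection \<open>The Poisson kernel and visual angles\<close>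

definition poisson_kernel :: "complex \<Rightarrow> complex \<Rightarrow> real" where
  "poisson_kernel z w = (1 - (norm z)\<^sup>2) / (norm (w - z))\<^sup>2"

lemma cis_diff_nonzero:
  assumes "norm z < 1" shows "cis t - z \<noteq> 0"
  using assms by auto

text \<open>Serves two purposes: the denominator in the Cauchy formula for the Poisson kernel does
  not vanish, and the argument of \<open>Ln\<close> in \<open>visual_angle\<close> stays in the
  right half-plane.\<close>

lemma one_minus_cnj_mult_Re_pos:
  assumes "norm (z::complex) < 1" "norm w \<le> 1" shows "0 < Re (1 - cnj w * z)"
proof -
  have "Re (cnj w * z) \<le> norm w * norm z"
    using complex_Re_le_cmod[of "cnj w * z"] by (simp add: norm_mult)
  also have "\<dots> \<le> 1 * norm z" using assms by (intro mult_right_mono) auto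
  finally show ?thesis using assms by simp
qed

lemma one_minus_cnj_mult_not_nonpos:
  assumes "norm (z::complex) < 1" "norm w \<le> 1" shows "1 - cnj w * z \<notin> \<real>\<^sub>\<le>\<^sub>0"
proof
  assume "1 - cnj w * z \<in> \<real>\<^sub>\<le>\<^sub>0"
  then have "Re (1 - cnj w * z) \<le> 0"
    by (rule complex_nonpos_Reals_iff[THEN iffD1, THEN conjunct1])
  then show False using one_minus_cnj_mult_Re_pos[OF assms] by linarith
qed

lemma poisson_kernel_nonneg: "norm z < 1 \<Longrightarrow> 0 \<le> poisson_kernel z w"
  by (simp add: poisson_kernel_def power_le_one)

lemma continuous_on_poisson_kernel:
  assumes "norm z < 1" shows "continuous_on A (\<lambda>t. poisson_kernel z (cis t))"
  unfolding poisson_kernel_def using cis_diff_nonzero[OF assms]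
  by (intro continuous_intros) auto

text \<open>Cauchy's formula for \<open>w \<mapsto> \<Psi> w * (1 - \<bar>z\<bar>\<^sup>2) / (1 - cnj z * w)\<close> at the point \<open>z\<close>.\<close>

lemma poisson_formula_holomorphic:
  fixes \<Psi> :: "complex \<Rightarrow> complex"
  assumes c: "continuous_on (cball 0 1) \<Psi>" and hol: "\<Psi> holomorphic_on ball 0 1"
    and z: "norm z < 1"
  shows "((\<lambda>t. of_real (poisson_kernel z (cis t)) * \<Psi> (cis t)) has_integral (2 * pi * \<Psi> z))
    {0..2*pi}"
proof -
  define H where "H w = \<Psi> w * of_real (1 - (norm z)\<^sup>2) / (1 - cnj z * w)" for w
  have nz: "1 - cnj z * w \<noteq> 0" if "norm w \<le> 1" for w
    using one_minus_cnj_mult_Re_pos[OF z that] by (auto simp: mult.commute complex_eq_iff)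
  have "((\<lambda>u. H u / (u - z)) has_contour_integral (2 * of_real pi * \<i> * H z)) (circlepath 0 1)"
  proof (rule Cauchy_integral_circlepath)
    show "continuous_on (cball 0 1) H"
      unfolding H_def using nz by (intro continuous_intros c) auto
    show "H holomorphic_on ball 0 1"
      unfolding H_def using nz by (intro holomorphic_intros hol) auto
  qed (use z in auto)
  then have "((\<lambda>t. H (cis t) / (cis t - z) * \<i> * cis t) has_integral
      (2 * of_real pi * \<i> * H z)) {0..2*pi}"
    unfolding circlepath_def by (subst (asm) has_contour_integral_part_circlepath_iff) auto
  from has_integral_mult_right[OF this, of "-\<i>"]
  have 1: "((\<lambda>t. - \<i> * (H (cis t) / (cis t - z) * \<i> * cis t)) has_integral
      (2 * of_real pi * H z)) {0..2*pi}"
    by (simp add: algebra_simps)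
  have Hz: "H z = \<Psi> z"
  proof -
    have "1 - cnj z * z = of_real (1 - (norm z)\<^sup>2)"
      by (simp only: of_real_diff complex_norm_square mult.commute) simp
    then show ?thesis using nz[of z] z unfolding H_def by (simp add: less_imp_le)
  qed
  have 2: "- \<i> * (H (cis t) / (cis t - z) * \<i> * cis t)
      = of_real (poisson_kernel z (cis t)) * \<Psi> (cis t)" for t
  proof -
    \<comment> \<open>On the unit circle \<open>1 - cnj z * cis t\<close> is \<open>cis t\<close>
      times the conjugate of \<open>cis t - z\<close>. The two denominators thus combine to the
      squared distance in the Poisson kernel, and the extra \<open>cis t\<close> cancels against the
      derivative of the path.\<close>
    have "(1 - cnj z * cis t) * (cis t - z) = cis t * of_real ((norm (cis t - z))\<^sup>2)"
    proof -
      have "of_real ((norm (cis t - z))\<^sup>2) = (cis t - z) * cnj (cis t - z)"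
        by (rule complex_norm_square)
      moreover have "1 - cnj z * cis t = cis t * cnj (cis t - z)"
        by (simp add: algebra_simps cis_cnj cis_mult)
      ultimately show ?thesis by simp
    qed
    moreover have "- \<i> * (H (cis t) / (cis t - z) * \<i> * cis t) =
       \<Psi> (cis t) * of_real (1 - (norm z)\<^sup>2) * cis t / ((1 - cnj z * cis t) * (cis t - z))"
      by (simp add: H_def algebra_simps)
    ultimately show ?thesis by (simp add: poisson_kernel_def)
  qed
  show ?thesis using 1 unfolding 2 Hz by simp
qed

lemma poisson_kernel_has_integral:
  assumes "norm z < 1"
  shows "((\<lambda>t. poisson_kernel z (cis t)) has_integral (2 * pi)) {0..2*pi}"
  using has_integral_Re[OF poisson_formula_holomorphic[of "\<lambda>_. 1", OF _ _ assms]] by simp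

lemma poisson_inequality_holomorphic:
  fixes \<Psi> :: "complex \<Rightarrow> complex"
  assumes c: "continuous_on (cball 0 1) \<Psi>" and hol: "\<Psi> holomorphic_on ball 0 1"
    and z: "norm z < 1"
  shows "2 * pi * norm (\<Psi> z) \<le>
    integral {0..2*pi} (\<lambda>t. poisson_kernel z (cis t) * norm (\<Psi> (cis t)))"
proof -
  have cc: "continuous_on {0..2*pi} (\<lambda>t. \<Psi> (cis t))"
    by (rule continuous_on_compose2[OF c]) (auto intro: continuous_intros)
  have "2 * pi * norm (\<Psi> z) = norm (2 * pi * \<Psi> z)"
    by (simp add: norm_mult)
  also have "2 * pi * \<Psi> z =
      integral {0..2*pi} (\<lambda>t. of_real (poisson_kernel z (cis t)) * \<Psi> (cis t))"
    by (rule integral_unique[symmetric]) (rule poisson_formula_holomorphic[OF assms])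
  also have "norm \<dots> \<le>
    integral {0..2*pi} (\<lambda>t. poisson_kernel z (cis t) * norm (\<Psi> (cis t)))"
    by (rule integral_norm_bound_integral)
      (auto intro!: integrable_continuous_real continuous_intros cc continuous_on_poisson_kernel z
        simp: norm_mult poisson_kernel_nonneg[OF z])
  finally show ?thesis .
qed

text \<open>The Poisson inequality is applied to \<open>h * Q\<close>, where the quadratic polynomial \<open>Q\<close> vanishes
  at the two points in which the line through \<open>z\<close> in direction \<open>d\<close> meets the unit circle.\<close>

lemma directional_poisson_inequality:
  fixes h :: "complex \<Rightarrow> complex"
  assumes c: "continuous_on (cball 0 1) h" and hol: "h holomorphic_on ball 0 1"
    and z: "norm z < 1"
  shows "norm d * norm (h z) \<le> 1 / pi * integral {0..2*pi}
    (\<lambda>t. norm (h (cis t)) * (\<bar>Im (cnj d * (cis t - z))\<bar> / (norm (cis t - z))\<^sup>2))"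
proof -
  define Q where "Q w = cnj d * w\<^sup>2 - 2 * \<i> * of_real (Im (cnj d * z)) * w - d" for w
  \<comment> \<open>At \<open>z\<close> the polynomial reproduces the numerator
    \<open>1 - (norm z)\<^sup>2\<close> of the Poisson kernel, so this factor cancels from both
    sides of the inequality. What remains on the circle is the weight \<open>\<bar>Im (cnj d * (cis
    t - z))\<bar> / (norm (cis t - z))\<^sup>2\<close>.\<close>
  have Qz: "norm (Q z) = norm d * (1 - (norm z)\<^sup>2)"
  proof -
    have "Q z = - d * of_real (1 - (norm z)\<^sup>2)"
      unfolding Q_def cmod_power2 by (auto simp: complex_eq_iff power2_eq_square algebra_simps)
    moreover have "(norm z)\<^sup>2 \<le> 1" using z by (simp add: power_le_one)
    ultimately show ?thesis by (simp add: norm_mult norm_minus_cancel norm_of_real del: of_real_diff of_real_power)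
  qed
  have Qw: "norm (Q (cis t)) = 2 * \<bar>Im (cnj d * (cis t - z))\<bar>" for t
  proof -
    have "cis t * (cnj d * cis t - d * cnj (cis t)) = cnj d * (cis t)\<^sup>2 - d * (cis t * cnj (cis t))"
      by (simp add: algebra_simps power2_eq_square)
    also have "cis t * cnj (cis t) = 1" by (simp add: cis_cnj cis_mult)
    finally have "Q (cis t) = cis t * (cnj d * cis t - d * cnj (cis t)
        - 2 * \<i> * of_real (Im (cnj d * z)))"
      by (simp add: Q_def algebra_simps)
    also have "cnj d * cis t - d * cnj (cis t) = 2 * \<i> * of_real (Im (cnj d * cis t))"
      by (auto simp: complex_eq_iff)
    finally have "Q (cis t) = cis t * (2 * \<i>) * of_real (Im (cnj d * (cis t - z)))"
      by (simp add: algebra_simps)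
    then show ?thesis by (simp only: norm_mult norm_cis norm_of_real) simp
  qed
  let ?J = "integral {0..2*pi}
    (\<lambda>t. norm (h (cis t)) * (\<bar>Im (cnj d * (cis t - z))\<bar> / (norm (cis t - z))\<^sup>2))"
  have pos: "0 < 2 * (1 - (norm z)\<^sup>2)" using z by (simp add: power_less_one_iff abs_square_less_1)
  have "2 * pi * norm (h z * Q z) \<le>
    integral {0..2*pi} (\<lambda>t. poisson_kernel z (cis t) * norm (h (cis t) * Q (cis t)))"
    unfolding Q_def
    by (rule poisson_inequality_holomorphic[OF _ _ z]; intro continuous_intros holomorphic_intros c hol)
  also have "(\<lambda>t. poisson_kernel z (cis t) * norm (h (cis t) * Q (cis t))) =
    (\<lambda>t. (2 * (1 - (norm z)\<^sup>2)) *
      (norm (h (cis t)) * (\<bar>Im (cnj d * (cis t - z))\<bar> / (norm (cis t - z))\<^sup>2)))"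
    by (simp add: poisson_kernel_def norm_mult Qw fun_eq_iff)
  also have "integral {0..2*pi} \<dots> = (2 * (1 - (norm z)\<^sup>2)) * ?J"
    by (rule integral_mult_right)
  also have "2 * pi * norm (h z * Q z) = (2 * (1 - (norm z)\<^sup>2)) * (pi * (norm d * norm (h z)))"
    by (simp add: norm_mult Qz)
  finally have "(2 * (1 - (norm z)\<^sup>2)) * (pi * (norm d * norm (h z))) \<le> (2 * (1 - (norm z)\<^sup>2)) * ?J" .
  then have "pi * (norm d * norm (h z)) \<le> ?J"
    using pos by (simp only: mult_le_cancel_left_pos)
  then show ?thesis by (simp add: field_simps)
qed

text \<open>For \<open>\<bar>w\<bar> = 1\<close> this is the angle between the ray from \<open>w\<close> through \<open>z\<close> and the inner normal
  of the unit circle at \<open>w\<close>; for \<open>\<bar>z\<bar> < 1\<close> the argument of \<open>Ln\<close> has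
  positive real part, so the branch cut is not met.\<close>

definition visual_angle :: "complex \<Rightarrow> complex \<Rightarrow> real" where
  "visual_angle w z = Im (Ln (1 - cnj w * z))"

text \<open>The integrand is the absolute speed of the visual angle along the segment. Moving
  \<open>z\<close> in direction \<open>d\<close> leaves the numerator
  \<open>k = Im (cnj d * (w - z))\<close> unchanged, so the angle is monotone and the integral of
  its absolute speed is the absolute difference of the end values.\<close>

lemma visual_angle_segment_has_integral:
  assumes z: "norm z0 < 1" "norm z1 < 1" and w: "norm w = 1"
  shows "((\<lambda>s. \<bar>Im (cnj (z1 - z0) * (w - (z0 + of_real s * (z1 - z0))))\<bar> /
      (norm (w - (z0 + of_real s * (z1 - z0))))\<^sup>2)
    has_integral \<bar>visual_angle w z1 - visual_angle w z0\<bar>) {0..1}"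
proof -
  define d where "d = z1 - z0"
  define Z where "Z s = z0 + of_real s * d" for s
  define k where "k = Im (cnj d * (w - z0))"
  have k: "Im (cnj d * (w - Z s)) = k" for s
    by (simp add: k_def Z_def algebra_simps)
  have Zin: "norm (Z s) < 1" if "0 \<le> s" "s \<le> 1" for s
  proof -
    have "Z s = (1 - s) *\<^sub>R z0 + s *\<^sub>R z1"
      by (simp add: Z_def d_def scaleR_conv_of_real algebra_simps)
    moreover have "(1 - s) *\<^sub>R z0 + s *\<^sub>R z1 \<in> ball 0 1"
      using convexD[OF convex_ball, of z0 0 1 z1 "1 - s" s] z that by auto
    ultimately show ?thesis by simp
  qed
  have deriv: "((\<lambda>s. visual_angle w (Z s)) has_vector_derivative (k / (norm (w - Z s))\<^sup>2))
      (at s within {0..1})" if s: "s \<in> {0..1}" for s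
  proof -
    have pos: "0 < Re (1 - cnj w * Z s)"
      using one_minus_cnj_mult_Re_pos[of "Z s" w] Zin[of s] s w by auto
    have ww: "cnj w * w = 1" using w by (simp add: complex_norm_square[symmetric] mult.commute)
    have nz: "w - Z s \<noteq> 0" using Zin[of s] s w by auto
    \<comment> \<open>Since |w| = 1, the logarithmic derivative of \<open>1 - cnj w * Z s\<close> is
      \<open>- d / (w - Z s)\<close>, whose imaginary part is \<open>k\<close> divided by the
      squared distance.\<close>
    have "1 - cnj w * Z s = cnj w * (w - Z s)" using ww by (simp add: algebra_simps)
    moreover have "cnj w \<noteq> 0" using w by auto
    ultimately have "inverse (1 - cnj w * Z s) * (- (cnj w * d)) = - (d / (w - Z s))"
      by (simp add: divide_inverse)
    then have e: "Im (inverse (1 - cnj w * Z s) * (- (cnj w * d))) = k / (norm (w - Z s))\<^sup>2"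
      unfolding k[symmetric, of s]
      by (simp add: complex_div_cnj[of d] del: of_real_power) (simp add: minus_divide_left algebra_simps)
    have nn: "1 - cnj w * Z s \<notin> \<real>\<^sub>\<le>\<^sub>0" using pos complex_nonpos_Reals_iff by force
    have "((\<lambda>s. 1 - cnj w * Z s) has_vector_derivative (- (cnj w * d))) (at s within {0..1})"
      unfolding Z_def by (auto intro!: derivative_eq_intros)
    from field_vector_diff_chain_within[OF this, of Ln "inverse (1 - cnj w * Z s)"]
    have "((\<lambda>s. Ln (1 - cnj w * Z s)) has_vector_derivative
        (- (cnj w * d)) * inverse (1 - cnj w * Z s)) (at s within {0..1})"
      using has_field_derivative_at_within[OF has_field_derivative_Ln[OF nn]]
      by (simp add: o_def)
    from bounded_linear.has_vector_derivative[OF bounded_linear_Im this]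
    show ?thesis using e by (simp add: visual_angle_def mult.commute)
  qed
  have "((\<lambda>s. k / (norm (w - Z s))\<^sup>2) has_integral
      (visual_angle w (Z 1) - visual_angle w (Z 0))) {0..1}"
    by (rule fundamental_theorem_of_calculus[OF _ deriv]) auto
  moreover have "Z 1 = z1" "Z 0 = z0" by (auto simp: Z_def d_def)
  ultimately have I: "((\<lambda>s. k / (norm (w - Z s))\<^sup>2) has_integral
      (visual_angle w z1 - visual_angle w z0)) {0..1}" by simp
  have "((\<lambda>s. \<bar>k\<bar> / (norm (w - Z s))\<^sup>2) has_integral
      \<bar>visual_angle w z1 - visual_angle w z0\<bar>) {0..1}"
  proof (cases "k \<ge> 0")
    case True
    have "0 \<le> visual_angle w z1 - visual_angle w z0"
      by (rule has_integral_nonneg[OF I]) (use True in auto)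
    then show ?thesis using I True by simp
  next
    case False
    have "0 \<le> - (visual_angle w z1 - visual_angle w z0)"
      by (rule has_integral_nonneg[OF has_integral_neg[OF I]]) (use False in \<open>simp add: divide_nonpos_nonneg\<close>)
    then show ?thesis using has_integral_neg[OF I] False by simp
  qed
  then show ?thesis
    unfolding d_def[symmetric] Z_def[symmetric] k .
qed

subsection \<open>Lines meeting the boundary of a convex set\<close>

text \<open>A convex set with empty interior lies in a hyperplane, whose normal works with equality
  on the whole closure. Otherwise the interior is the relative interior and the supporting
  hyperplane at the relative frontier is available. The degenerate case covers segments.\<close>

lemma supporting_hyperplane_frontier:
  fixes K :: "'a::euclidean_space set"
  assumes K: "convex K" and x: "x \<in> frontier K"
  obtains a where "a \<noteq> 0" "\<And>y. y \<in> closure K \<Longrightarrow> a \<bullet> x \<le> a \<bullet> y"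
proof (cases "interior K = {}")
  case True
  obtain a b where a: "a \<noteq> 0" "K \<subseteq> {y. a \<bullet> y = b}"
    using empty_interior_subset_hyperplane[OF K True] by metis
  have "closure K \<subseteq> {y. a \<bullet> y = b}"
    using closure_minimal[OF a(2) closed_hyperplane] .
  then show ?thesis using a(1) x that[of a] by (auto simp: frontier_def subset_iff)
next
  case False
  then have "x \<in> closure K" "x \<notin> rel_interior K"
    using x rel_interior_nonempty_interior[OF False] by (auto simp: frontier_def)
  then show ?thesis using supporting_hyperplane_relative_frontier[OF K] that by metis
qed

lemma visual_angle_bounds:
  assumes "norm z < 1" "norm w = 1"
  shows "\<bar>visual_angle w z\<bar> < pi / 2"
  unfolding visual_angle_def
  using Re_Ln_pos_lt[of "1 - cnj w * z"] one_minus_cnj_mult_Re_pos[of z w] assms by fastforce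

text \<open>Polar coordinates about \<open>w\<close> with the inner normal \<open>- w\<close> as
  axis and \<open>r\<close> the distance from \<open>w\<close> to \<open>z\<close>. Points with
  equal visual angle therefore lie on one ray from \<open>w\<close>.\<close>

lemma visual_angle_polar:
  assumes "norm z < 1" and w: "norm w = 1"
  obtains r where "0 < r" "z = w - of_real r * (w * cis (visual_angle w z))"
proof -
  let ?v = "1 - cnj w * z"
  have nz: "?v \<noteq> 0" using one_minus_cnj_mult_Re_pos[of z w] assms by force
  have "?v = exp (Ln ?v)" using nz by simp
  also have "\<dots> = of_real (norm ?v) * cis (visual_angle w z)"
    using nz by (simp add: exp_eq_polar visual_angle_def exp_of_real[symmetric])
  finally have v: "w * ?v = of_real (norm ?v) * (w * cis (visual_angle w z))"
    by (simp only: mult_ac)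
  have "w * cnj w = 1" using w by (simp add: complex_norm_square[symmetric])
  then have "w * ?v = w - z" by (simp add: algebra_simps)
  then have "z = w - w * ?v" by simp
  then have "z = w - of_real (norm ?v) * (w * cis (visual_angle w z))"
    unfolding v .
  moreover have "0 < norm ?v" using nz by simp
  ultimately show ?thesis using that by blast
qed

text \<open>A supporting functional at the middle point is affine along the line and has a minimum
  at an interior parameter, so it is constant there. Hence the line itself supports
  \<open>K\<close>, and the sign of \<open>\<sigma>\<close> tells on which side \<open>K\<close>
  lies.\<close>

lemma collinear_frontier_imp_supporting_line:
  fixes K :: "complex set"
  assumes K: "convex K" and p: "p1 \<in> frontier K" "p2 \<in> frontier K" "p3 \<in> frontier K"
    and r: "p1 = w - of_real r1 * e" "p2 = w - of_real r2 * e" "p3 = w - of_real r3 * e"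
    and lt: "r1 < r2" "r2 < r3" and e: "e \<noteq> 0"
  obtains \<sigma> :: real where "\<sigma> \<noteq> 0" "\<And>y. y \<in> frontier K \<Longrightarrow> 0 \<le> \<sigma> * Im (cnj e * (w - y))"
proof -
  obtain a where a: "a \<noteq> 0" "\<And>y. y \<in> closure K \<Longrightarrow> a \<bullet> p2 \<le> a \<bullet> y"
    by (rule supporting_hyperplane_frontier[OF K p(2)]) blast
  have cl: "frontier K \<subseteq> closure K" by (auto simp: frontier_def)
  have eq: "a \<bullet> (w - of_real r * e) = a \<bullet> w - r * (a \<bullet> e)" for r
    by (simp add: inner_diff_right scaleR_conv_of_real[symmetric])
  have "r1 * (a \<bullet> e) \<le> r2 * (a \<bullet> e)" "r3 * (a \<bullet> e) \<le> r2 * (a \<bullet> e)"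
    using a(2)[of p1] a(2)[of p3] p cl unfolding r eq by auto
  then have "(r2 - r1) * (a \<bullet> e) \<ge> 0" "(r3 - r2) * (a \<bullet> e) \<le> 0"
    by (auto simp: algebra_simps)
  then have ae: "a \<bullet> e = 0" using lt by (auto simp: zero_le_mult_iff mult_le_0_iff)
  define \<sigma> where "\<sigma> = - Im (cnj e * a)"
  \<comment> \<open>In the plane, orthogonality to \<open>e\<close> makes the functional of
    \<open>a\<close> a real multiple of \<open>v \<mapsto> Im (cnj e * v)\<close>.\<close>
  have nrm: "norm e ^ 2 * (a \<bullet> v) = Im (cnj e * a) * Im (cnj e * v)" for v
  proof -
    have "norm e ^ 2 * (a \<bullet> v) = (a \<bullet> e) * (e \<bullet> v) + Im (cnj e * a) * Im (cnj e * v)"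
      unfolding inner_complex_def cmod_power2 by (simp add: algebra_simps power2_eq_square)
    then show ?thesis by (simp add: ae)
  qed
  have "\<sigma> \<noteq> 0"
  proof
    assume "\<sigma> = 0"
    then have "norm e ^ 2 * (a \<bullet> a) = 0" using nrm[of a] by (simp add: \<sigma>_def)
    then show False using e a(1) by simp
  qed
  moreover have "0 \<le> \<sigma> * Im (cnj e * (w - y))" if y: "y \<in> frontier K" for y
  proof -
    have "a \<bullet> p2 = a \<bullet> w" unfolding r eq ae by simp
    then have "a \<bullet> (w - y) \<le> 0" using a(2)[of y] cl y by (auto simp: inner_diff_right)
    then have "norm e ^ 2 * (a \<bullet> (w - y)) \<le> 0" by (simp add: mult_le_0_iff)
    then show ?thesis unfolding nrm \<sigma>_def by (simp add: algebra_simps)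
  qed
  ultimately show ?thesis by (rule that)
qed

text \<open>The line through \<open>w\<close> in an exceptional direction supports \<open>K\<close>, so this direction is
  either the least or the greatest exceptional one.\<close>

lemma finite_exceptional_angles:
  fixes K :: "complex set"
  assumes K: "convex K" and w: "norm w = 1"
  shows "finite {x. \<exists>p1 p2 p3. {p1, p2, p3} \<subseteq> frontier K \<inter> ball 0 1 \<and>
    p1 \<noteq> p2 \<and> p1 \<noteq> p3 \<and> p2 \<noteq> p3 \<and>
    visual_angle w p1 = x \<and> visual_angle w p2 = x \<and> visual_angle w p3 = x}" (is "finite ?N")
proof -
  have key: "(\<forall>x'\<in>?N. x \<le> x') \<or> (\<forall>x'\<in>?N. x' \<le> x)" if x: "x \<in> ?N" for x
  proof -
    define e where "e = w * cis x"
    have e: "e \<noteq> 0" using w by (auto simp: e_def)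
    obtain p1 p2 p3 where p: "{p1, p2, p3} \<subseteq> frontier K \<inter> ball 0 1"
      "p1 \<noteq> p2" "p1 \<noteq> p3" "p2 \<noteq> p3"
      "visual_angle w p1 = x" "visual_angle w p2 = x" "visual_angle w p3 = x"
      using x by auto
    define R where "R = {r. w - of_real r * e \<in> frontier K}"
    have "\<exists>r. q = w - of_real r * e" if "norm q < 1" "visual_angle w q = x" for q
      using visual_angle_polar[OF that(1) w] that(2) unfolding e_def by metis
    then obtain r1 r2 r3 where r: "p1 = w - of_real r1 * e" "p2 = w - of_real r2 * e"
      "p3 = w - of_real r3 * e"
      using p by (metis insert_subset Int_iff mem_ball_0)
    have rR: "r1 \<in> R" "r2 \<in> R" "r3 \<in> R" using p(1) by (auto simp: R_def r)
    have "r1 \<noteq> r2" "r1 \<noteq> r3" "r2 \<noteq> r3" using p(2-4) by (auto simp: r)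
    then have "\<exists>a\<in>R. \<exists>b\<in>R. \<exists>c\<in>R. a < b \<and> b < c"
      using rR by (meson linorder_neqE_linordered_idom)
    then obtain a b c where abc: "a \<in> R" "b \<in> R" "c \<in> R" "a < b" "b < c" by blast
    obtain \<sigma> :: real where \<sigma>: "\<sigma> \<noteq> 0"
      "\<And>y. y \<in> frontier K \<Longrightarrow> 0 \<le> \<sigma> * Im (cnj e * (w - y))"
      using collinear_frontier_imp_supporting_line[OF K _ _ _ refl refl refl abc(4,5) e] abc(1-3)
      unfolding R_def by blast
    \<comment> \<open>In polar coordinates about \<open>w\<close> the side of the line on which a
      point lies is the sign of \<open>sin (x' - x)\<close>. Visual angles differ by less than pi,
      so this is the sign of \<open>x' - x\<close>.\<close>
    have sgn: "0 \<le> \<sigma> * sin (x' - x)" "\<bar>x' - x\<bar> < pi" if "x' \<in> ?N" for x'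
    proof -
      obtain q where q: "q \<in> frontier K" "norm q < 1" "visual_angle w q = x'"
        using \<open>x' \<in> ?N\<close> by auto
      obtain r where r: "0 < r" "q = w - of_real r * (w * cis x')"
        using visual_angle_polar[OF q(2) w] q(3) by metis
      have "cnj e * (w - q) = of_real r * ((w * cnj w) * cis (x' - x))"
        unfolding r(2) e_def by (simp add: cis_cnj cis_mult algebra_simps)
      also have "w * cnj w = 1" using w by (simp add: complex_norm_square[symmetric])
      finally have "Im (cnj e * (w - q)) = r * sin (x' - x)" by simp
      then show "0 \<le> \<sigma> * sin (x' - x)"
        using \<sigma>(2)[OF q(1)] r(1) by (auto simp: zero_le_mult_iff mult_le_0_iff)
      show "\<bar>x' - x\<bar> < pi"
        using visual_angle_bounds[OF q(2) w] visual_angle_bounds[of p1 w] p w q(3) by auto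
    qed
    show ?thesis
    proof (cases "\<sigma> > 0")
      case True
      have "x \<le> x'" if "x' \<in> ?N" for x'
      proof (rule ccontr)
        assume "\<not> x \<le> x'"
        then have "sin (x - x') > 0" using sgn(2)[OF that] by (intro sin_gt_zero) auto
        then have "sin (x' - x) < 0" using sin_minus[of "x - x'"] by simp
        then show False using sgn(1)[OF that] True by (simp add: zero_le_mult_iff)
      qed
      then show ?thesis by blast
    next
      case False
      have "x' \<le> x" if "x' \<in> ?N" for x'
      proof (rule ccontr)
        assume "\<not> x' \<le> x"
        then have "sin (x' - x) > 0" using sgn(2)[OF that] by (intro sin_gt_zero) auto
        then show False using sgn(1)[OF that] False \<sigma>(1) by (simp add: zero_le_mult_iff)
      qed
      then show ?thesis by blast
    qed
  qed
  have single: "finite A" if "\<And>x y. x \<in> A \<Longrightarrow> y \<in> A \<Longrightarrow> x = y" for A :: "real set"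
  proof (cases "A = {}")
    case False
    then obtain a where "a \<in> A" by auto
    then have "A \<subseteq> {a}" using that by auto
    then show ?thesis using finite_subset by auto
  qed simp
  define N where "N = ?N"
  define L where "L = {x \<in> N. \<forall>x'\<in>N. x \<le> x'}"
  define U where "U = {x \<in> N. \<forall>x'\<in>N. x' \<le> x}"
  have "finite L" by (rule single) (auto simp: L_def intro: antisym)
  moreover have "finite U" by (rule single) (auto simp: U_def intro: antisym)
  moreover have "N \<subseteq> L \<union> U" using key unfolding N_def[symmetric] L_def U_def by blast
  ultimately have "finite N" using finite_subset by blast
  then show ?thesis unfolding N_def .
qed

section \<open>Sums over consecutive parameters and a bound for the total variation\<close>

definition polygon_sum :: "(real \<Rightarrow> real \<Rightarrow> real) \<Rightarrow> real list \<Rightarrow> real" where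
  "polygon_sum \<phi> xs = (\<Sum>i<length xs - 1. \<phi> (xs ! i) (xs ! Suc i))"

lemma polygon_sum_Cons: "polygon_sum \<phi> (x # y # zs) = \<phi> x y + polygon_sum \<phi> (y # zs)"
  by (simp add: polygon_sum_def sum.lessThan_Suc_shift del: sum.lessThan_Suc)

lemma polygon_sum_short [simp]: "polygon_sum \<phi> [] = 0" "polygon_sum \<phi> [x] = 0"
  by (simp_all add: polygon_sum_def)

text \<open>Only an inequality, because concatenation adds the edge from the last entry of
  \<open>xs\<close> to the first entry of \<open>ys\<close>; nonnegativity of \<open>\<phi>\<close>
  allows dropping it.\<close>

lemma polygon_sum_append:
  assumes "\<And>s t. 0 \<le> \<phi> s t"
  shows "polygon_sum \<phi> xs + polygon_sum \<phi> ys \<le> polygon_sum \<phi> (xs @ ys)"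
proof (induction xs rule: induct_list012)
  case (2 x)
  show ?case using assms by (cases ys) (auto simp: polygon_sum_Cons)
qed (auto simp: polygon_sum_Cons)

lemma polygon_sum_mono:
  assumes "\<And>s t. s \<in> set xs \<Longrightarrow> t \<in> set xs \<Longrightarrow> \<phi> s t \<le> \<psi> s t"
  shows "polygon_sum \<phi> xs \<le> polygon_sum \<psi> xs"
  unfolding polygon_sum_def by (intro sum_mono assms) auto

lemma polygon_sum_mult_left: "polygon_sum (\<lambda>s t. c * \<phi> s t) xs = c * polygon_sum \<phi> xs"
  by (simp add: polygon_sum_def sum_distrib_left)

text \<open>An elementary form of Banach's indicatrix formula.\<close>

lemma variation_le_of_multiplicity:
  fixes g :: "real \<Rightarrow> real"
  assumes cont: "continuous_on {a..b} g" and rng: "\<And>s. s \<in> {a..b} \<Longrightarrow> g s \<in> {c..d}"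
    and fin: "finite N" and cd: "c \<le> d"
    and mult: "\<And>s1 s2 s3. \<lbrakk>a < s1; s1 < s2; s2 < s3; s3 < b; g s2 = g s1; g s3 = g s1\<rbrakk> \<Longrightarrow> g s1 \<in> N"
    and xs: "sorted xs" "set xs \<subseteq> {a..b}"
  shows "polygon_sum (\<lambda>s t. \<bar>g t - g s\<bar>) xs \<le> 2 * (d - c)"
proof -
  define n where "n = length xs - 1"
  \<comment> \<open>The values strictly between those at consecutive nodes; \<open>cnt\<close>
    counts the edges whose set \<open>B i\<close> contains a given level, and its integral is the
    sum to be bounded. Taking open intervals ensures that a level in \<open>B i\<close> is attained
    strictly between the two nodes, which gives strictly increasing parameters different from
    \<open>a\<close> and \<open>b\<close>.\<close>
  define B where "B i = {min (g (xs ! i)) (g (xs ! Suc i)) <..< max (g (xs ! i)) (g (xs ! Suc i))}" for i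
  define cnt where "cnt x = (\<Sum>i<n. if x \<in> B i then 1 else 0 :: real)" for x
  have mem: "xs ! i \<in> {a..b}" "xs ! Suc i \<in> {a..b}" if "i < n" for i
  proof -
    have "xs ! i \<in> set xs" "xs ! Suc i \<in> set xs" using that by (auto simp: n_def)
    then show "xs ! i \<in> {a..b}" "xs ! Suc i \<in> {a..b}" using xs(2) by blast+
  qed
  have hi: "((\<lambda>x. if x \<in> B i then 1 else 0 :: real) has_integral \<bar>g (xs ! Suc i) - g (xs ! i)\<bar>) {c..d}"
    if i: "i < n" for i
  proof -
    have sub: "B i \<subseteq> {c..d}"
      using rng[OF mem(1)[OF i]] rng[OF mem(2)[OF i]] by (auto simp: B_def)
    have "((\<lambda>x. 1 :: real) has_integral \<bar>g (xs ! Suc i) - g (xs ! i)\<bar>) (B i)"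
      unfolding B_def has_integral_Icc_iff_Ioo[symmetric]
      using has_integral_const_real[of "1::real" "min (g (xs ! i)) (g (xs ! Suc i))"
          "max (g (xs ! i)) (g (xs ! Suc i))"]
      by (simp add: max_def min_def abs_if split: if_splits)
    then show ?thesis by (simp only: has_integral_restrict[OF sub])
  qed
  have I: "(cnt has_integral polygon_sum (\<lambda>s t. \<bar>g t - g s\<bar>) xs) {c..d}"
    unfolding cnt_def polygon_sum_def n_def[symmetric]
    by (rule has_integral_sum) (use hi in auto)
  have ivt: "\<exists>s. xs ! i < s \<and> s < xs ! Suc i \<and> g s = x" if i: "i < n" "x \<in> B i" for i x
  proof -
    have le: "xs ! i \<le> xs ! Suc i" using xs(1) i(1) by (intro sorted_nth_mono) (auto simp: n_def)
    have c: "continuous_on {xs ! i..xs ! Suc i} g"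
      by (rule continuous_on_subset[OF cont]) (use mem[OF i(1)] in auto)
    have "\<exists>s. xs ! i \<le> s \<and> s \<le> xs ! Suc i \<and> g s = x"
    proof (cases "g (xs ! i) \<le> g (xs ! Suc i)")
      case True
      show ?thesis by (rule IVT') (use True i le c in \<open>auto simp: B_def\<close>)
    next
      case False
      show ?thesis by (rule IVT2') (use False i le c in \<open>auto simp: B_def\<close>)
    qed
    then obtain s where s: "xs ! i \<le> s" "s \<le> xs ! Suc i" "g s = x" by blast
    then have "s \<noteq> xs ! i" "s \<noteq> xs ! Suc i" using i(2) by (auto simp: B_def)
    then show ?thesis using s by force
  qed
  \<comment> \<open>If three edges cross the level, the least, the greatest and any further crossed
    edge give parameters \<open>s1 < s2 < s3\<close> with the same value, which puts
    \<open>x\<close> into \<open>N\<close>.\<close>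
  have two: "cnt x \<le> 2" if x: "x \<notin> N" for x
  proof (rule ccontr)
    define A where "A = {i. i < n \<and> x \<in> B i}"
    have finA: "finite A" by (simp add: A_def)
    have "{..<n} \<inter> {i. x \<in> B i} = A" by (auto simp: A_def)
    then have "cnt x = real (card A)" by (simp add: cnt_def sum.If_cases)
    moreover assume "\<not> cnt x \<le> 2"
    ultimately have card: "card A > 2" by simp
    then have "A \<noteq> {}" by auto
    then have ik: "Min A \<in> A" "Max A \<in> A" using finA by auto
    have "\<not> A \<subseteq> {Min A, Max A}"
    proof
      assume "A \<subseteq> {Min A, Max A}"
      then have "card A \<le> card {Min A, Max A}" by (intro card_mono) auto
      also have "\<dots> \<le> 2" by (simp add: card_insert_if)
      finally show False using card by simp
    qed
    then obtain j where j: "j \<in> A" "j \<noteq> Min A" "j \<noteq> Max A" by blast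
    then have lt: "Min A < j" "j < Max A"
      using Min_le[OF finA j(1)] Max_ge[OF finA j(1)] by auto
    have mono: "xs ! Suc i \<le> xs ! k" if "i < k" "k < n" for i k
      using xs(1) that by (intro sorted_nth_mono) (auto simp: n_def)
    obtain s1 where s1: "xs ! Min A < s1" "s1 < xs ! Suc (Min A)" "g s1 = x"
      using ivt[of "Min A" x] ik(1) by (auto simp: A_def)
    obtain s2 where s2: "xs ! j < s2" "s2 < xs ! Suc j" "g s2 = x"
      using ivt[of j x] j(1) by (auto simp: A_def)
    obtain s3 where s3: "xs ! Max A < s3" "s3 < xs ! Suc (Max A)" "g s3 = x"
      using ivt[of "Max A" x] ik(2) by (auto simp: A_def)
    have n: "Min A < n" "j < n" "Max A < n" using ik j by (auto simp: A_def)
    have "g s1 \<in> N"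
    proof (rule mult)
      show "a < s1" using s1 mem(1)[OF n(1)] by auto
      show "s1 < s2" using s1 s2 mono[OF lt(1) n(2)] by auto
      show "s2 < s3" using s2 s3 mono[OF lt(2) n(3)] by auto
      show "s3 < b" using s3 mem(2)[OF n(3)] by auto
    qed (use s1 s2 s3 in auto)
    then show False using x s1(3) by simp
  qed
  have "((\<lambda>x. if x \<in> N then 0 else cnt x) has_integral
      polygon_sum (\<lambda>s t. \<bar>g t - g s\<bar>) xs) {c..d}"
    by (rule has_integral_spike_finite[OF fin _ I]) auto
  moreover have "((\<lambda>x. 2) has_integral (2 * (d - c))) {c..d}"
    using has_integral_const_real[of "2::real" c d] cd by (simp add: algebra_simps)
  ultimately show ?thesis
    by (rule has_integral_le) (use two in auto)
qed

section \<open>Integrals over segments\<close>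

definition segment_integral :: "(complex \<Rightarrow> real) \<Rightarrow> complex \<Rightarrow> complex \<Rightarrow> real" where
  "segment_integral u p q = norm (q - p) * integral {0..1} (\<lambda>s. u (p + of_real s * (q - p)))"

lemma segment_point_in_ball:
  fixes p q :: complex
  assumes "p \<in> ball c r" "q \<in> ball c r" "0 \<le> s" "s \<le> 1"
  shows "p + of_real s * (q - p) \<in> ball c r"
proof -
  have "p + of_real s * (q - p) = (1 - s) *\<^sub>R p + s *\<^sub>R q"
    by (simp add: scaleR_conv_of_real algebra_simps)
  also have "\<dots> \<in> ball c r" using convexD[OF convex_ball assms(1,2), of "1 - s" s] assms by auto
  finally show ?thesis .
qed

lemma continuous_on_segment:
  fixes p q :: complex
  assumes "continuous_on (ball c r) u" "p \<in> ball c r" "q \<in> ball c r"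
  shows "continuous_on {0..1} (\<lambda>s. u (p + of_real s * (q - p)))"
  by (rule continuous_on_compose2[OF assms(1)])
    (use segment_point_in_ball[OF assms(2,3)] in \<open>auto intro!: continuous_intros\<close>)

lemma continuous_on_visual_angle:
  assumes "norm z < 1" shows "continuous_on A (\<lambda>t. visual_angle (cis t) z)"
  unfolding visual_angle_def using one_minus_cnj_mult_not_nonpos[OF assms]
  by (intro continuous_intros) simp

text \<open>The directional Poisson inequality is integrated along the segment. After exchanging the
  order of integration, the inner integral over the segment is the angle under which it is seen from
  \<open>cis t\<close>.\<close>

lemma segment_integral_le_visual_angle:
  fixes h :: "complex \<Rightarrow> complex"
  assumes c: "continuous_on (cball 0 1) h" and hol: "h holomorphic_on ball 0 1"
    and z: "norm z0 < 1" "norm z1 < 1"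
  shows "segment_integral (\<lambda>z. norm (h z)) z0 z1 \<le> 1 / pi * integral {0..2*pi}
    (\<lambda>t. norm (h (cis t)) * \<bar>visual_angle (cis t) z1 - visual_angle (cis t) z0\<bar>)"
proof -
  define d where "d = z1 - z0"
  define Z where "Z s = z0 + of_real s * d" for s
  define G where "G s t = norm (h (cis t)) * (\<bar>Im (cnj d * (cis t - Z s))\<bar> / (norm (cis t - Z s))\<^sup>2)" for s t
  have Z: "norm (Z s) < 1" if "0 \<le> s" "s \<le> 1" for s
    using segment_point_in_ball[of z0 0 1 z1 s] z that by (simp add: Z_def d_def)
  have hc: "continuous_on ({0..1} \<times> {0..2*pi}) (\<lambda>x. h (cis (snd x)))"
    by (rule continuous_on_compose2[OF c]) (auto intro!: continuous_intros)
  have nz: "cis t - Z s \<noteq> 0" if "0 \<le> s" "s \<le> 1" for s t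
    using cis_diff_nonzero[OF Z[OF that]] .
  have Gc: "continuous_on ({0..1} \<times> {0..2*pi}) (\<lambda>(s, t). G s t)"
    unfolding G_def split_beta Z_def
    by (intro continuous_intros hc) (use nz in \<open>auto simp: Z_def\<close>)
  have "continuous_on (ball 0 1) (\<lambda>z. norm (h z))"
    by (intro continuous_intros continuous_on_subset[OF c]) auto
  from continuous_on_segment[OF this] have hZ: "continuous_on {0..1} (\<lambda>s. norm (h (Z s)))"
    using z by (simp add: Z_def d_def)
  have Gi: "(\<lambda>s. integral {0..2*pi} (G s)) integrable_on {0..1}"
    by (intro integrable_continuous_real)
      (use integral_continuous_on_param[of "{0..1}" 0 "2*pi" G] Gc in simp)
  have "segment_integral (\<lambda>z. norm (h z)) z0 z1 = integral {0..1} (\<lambda>s. norm d * norm (h (Z s)))"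
    by (simp add: segment_integral_def d_def Z_def)
  also have "\<dots> \<le> integral {0..1} (\<lambda>s. 1 / pi * integral {0..2*pi} (G s))"
  proof (rule integral_le)
    show "norm d * norm (h (Z s)) \<le> 1 / pi * integral {0..2*pi} (G s)" if "s \<in> {0..1}" for s
      unfolding G_def by (rule directional_poisson_inequality[OF c hol Z]) (use that in auto)
    show "(\<lambda>s. norm d * norm (h (Z s))) integrable_on {0..1}"
      by (intro integrable_continuous_real continuous_intros hZ)
    show "(\<lambda>s. 1 / pi * integral {0..2*pi} (G s)) integrable_on {0..1}"
      by (rule integrable_on_mult_right[OF Gi])
  qed
  also have "\<dots> = 1 / pi * integral {0..1} (\<lambda>s. integral {0..2*pi} (G s))"
    by (rule integral_mult_right)
  also have "integral {0..1} (\<lambda>s. integral {0..2*pi} (G s)) =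
      integral {0..2*pi} (\<lambda>t. integral {0..1} (\<lambda>s. G s t))"
    using integral_swap_continuous[of 0 0 1 "2*pi" G] Gc by (simp add: cbox_Pair_eq)
  also have "(\<lambda>t. integral {0..1} (\<lambda>s. G s t)) =
    (\<lambda>t. norm (h (cis t)) * \<bar>visual_angle (cis t) z1 - visual_angle (cis t) z0\<bar>)"
  proof
    fix t
    have "((\<lambda>s. \<bar>Im (cnj d * (cis t - Z s))\<bar> / (norm (cis t - Z s))\<^sup>2) has_integral
        \<bar>visual_angle (cis t) z1 - visual_angle (cis t) z0\<bar>) {0..1}"
      unfolding d_def Z_def by (rule visual_angle_segment_has_integral[OF z]) simp
    then show "integral {0..1} (\<lambda>s. G s t) =
        norm (h (cis t)) * \<bar>visual_angle (cis t) z1 - visual_angle (cis t) z0\<bar>"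
      unfolding G_def by (intro integral_unique has_integral_mult_right)
  qed
  finally show ?thesis .
qed

subsection \<open>Integration along convex curves\<close>

lemma polygon_sum_le_curve_length:
  assumes "sorted xs" "set xs \<subseteq> {a..b}"
  shows "ennreal (polygon_sum (\<lambda>s t. dist (\<gamma> s) (\<gamma> t)) xs) \<le> curve_length \<gamma> a b"
  unfolding curve_length_def polygon_sum_def by (rule SUP_upper) (use assms in auto)

lemma arc_length_parametrized_polygon_le:
  assumes \<gamma>: "arc_length_parametrized \<gamma> I" and I: "s \<in> I" "t \<in> I" "s \<le> t"
    and xs: "sorted xs" "set xs \<subseteq> {s..t}"
  shows "polygon_sum (\<lambda>s t. dist (\<gamma> s) (\<gamma> t)) xs \<le> t - s"
proof -
  have "ennreal (polygon_sum (\<lambda>s t. dist (\<gamma> s) (\<gamma> t)) xs) \<le> ennreal (t - s)"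
    using polygon_sum_le_curve_length[OF xs, of \<gamma>] \<gamma> I by (simp add: arc_length_parametrized_def)
  then show ?thesis using I by (simp add: ennreal_le_iff)
qed

lemma arc_length_parametrized_dist_le:
  assumes \<gamma>: "arc_length_parametrized \<gamma> I" and I: "s \<in> I" "t \<in> I"
  shows "dist (\<gamma> s) (\<gamma> t) \<le> \<bar>s - t\<bar>"
proof (cases "s \<le> t")
  case True
  show ?thesis
    using arc_length_parametrized_polygon_le[OF \<gamma> I True, of "[s, t]"] True
    by (simp add: polygon_sum_Cons)
next
  case False
  then show ?thesis
    using arc_length_parametrized_polygon_le[OF \<gamma> I(2,1), of "[t, s]"]
    by (simp add: polygon_sum_Cons dist_commute)
qed

lemma arc_length_parametrized_continuous:
  assumes "arc_length_parametrized \<gamma> I" shows "continuous_on I \<gamma>"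
proof -
  have "1-lipschitz_on I \<gamma>"
    using arc_length_parametrized_dist_le[OF assms] by (auto intro!: lipschitz_onI simp: dist_real_def)
  then show ?thesis by (rule lipschitz_on_continuous_on)
qed

lemma arc_length_parametrized_polygon_approx:
  assumes \<gamma>: "arc_length_parametrized \<gamma> I" and I: "s \<in> I" "t \<in> I" "s < t" and e: "0 < e"
  obtains xs where "sorted xs" "set xs \<subseteq> {s..t}"
    "t - s - e < polygon_sum (\<lambda>s t. dist (\<gamma> s) (\<gamma> t)) xs"
proof (cases "t - s - e < 0")
  case True
  then show ?thesis using that[of "[]"] by simp
next
  case False
  have "ennreal (t - s - e) < curve_length \<gamma> s t"
    using \<gamma> I e False by (simp add: arc_length_parametrized_def ennreal_lessI)
  then obtain xs where xs: "sorted xs" "set xs \<subseteq> {s..t}"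
    "ennreal (t - s - e) < ennreal (polygon_sum (\<lambda>s t. dist (\<gamma> s) (\<gamma> t)) xs)"
    unfolding curve_length_def polygon_sum_def less_SUP_iff by auto
  then have "t - s - e < polygon_sum (\<lambda>s t. dist (\<gamma> s) (\<gamma> t)) xs"
    using False ennreal_less_iff by simp
  then show ?thesis using that xs by blast
qed

lemma segment_integral_nonneg:
  assumes "continuous_on (ball c r) u" "p \<in> ball c r" "q \<in> ball c r" "\<And>z. z \<in> ball c r \<Longrightarrow> 0 \<le> u z"
  shows "0 \<le> segment_integral u p q"
  unfolding segment_integral_def
  by (intro mult_nonneg_nonneg integral_nonneg integrable_continuous_real
      continuous_on_segment[OF assms(1-3)] assms(4) segment_point_in_ball[OF assms(2,3)]) auto

lemma segment_integral_ge:
  assumes "continuous_on (ball c r) u" "p \<in> ball c r" "q \<in> ball c r" "\<And>z. z \<in> ball c r \<Longrightarrow> m \<le> u z"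
  shows "m * dist p q \<le> segment_integral u p q"
proof -
  have "integral {0..1} (\<lambda>s::real. m) \<le> integral {0..1} (\<lambda>s. u (p + of_real s * (q - p)))"
    by (intro integral_le integrable_continuous_real continuous_on_const
        continuous_on_segment[OF assms(1-3)] assms(4) segment_point_in_ball[OF assms(2,3)]) auto
  then have "m \<le> integral {0..1} (\<lambda>s. u (p + of_real s * (q - p)))" by simp
  then have "norm (q - p) * m \<le> segment_integral u p q"
    unfolding segment_integral_def by (intro mult_left_mono) auto
  then show ?thesis by (simp add: dist_norm norm_minus_commute mult.commute)
qed

text \<open>The error \<open>\<eta> * (b - a)\<close> is proportional to the length of the interval,
  so the claim passes to a union of adjacent intervals. By bisection it suffices to treat short
  intervals around each \<open>x\<close>, where \<open>u\<close> is nearly constant and the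
  inscribed polygon has nearly the length of the arc.\<close>

lemma curve_integral_le_polygon_sum:
  assumes \<gamma>: "arc_length_parametrized \<gamma> I" and ab: "{a..b} \<subseteq> I" "a \<le> b"
    and ball: "\<gamma> ` {a..b} \<subseteq> ball 0 1"
    and u: "continuous_on (ball 0 1) u" "\<And>z. z \<in> ball 0 1 \<Longrightarrow> 0 \<le> u z"
    and \<eta>: "0 < \<eta>"
  obtains xs where "sorted xs" "set xs \<subseteq> {a..b}"
    "integral {a..b} (\<lambda>s. u (\<gamma> s)) - \<eta> * (b - a) \<le>
      polygon_sum (\<lambda>s t. segment_integral u (\<gamma> s) (\<gamma> t)) xs"
proof -
  let ?u = "\<lambda>s. u (\<gamma> s)"
  \<comment> \<open>The value 0 outside \<open>{a..b}\<close> makes the weight nonnegative for all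
    parameters, as \<open>polygon_sum_append\<close> demands.\<close>
  define \<sigma> where "\<sigma> s t = (if s \<in> {a..b} \<and> t \<in> {a..b} then segment_integral u (\<gamma> s) (\<gamma> t) else 0)" for s t
  have \<sigma>nn: "0 \<le> \<sigma> s t" for s t
    unfolding \<sigma>_def using segment_integral_nonneg[OF u(1) _ _ u(2)] ball by (auto simp: image_subset_iff)
  have \<gamma>c: "continuous_on {a..b} \<gamma>"
    using arc_length_parametrized_continuous[OF \<gamma>] ab(1) by (rule continuous_on_subset)
  have uc: "continuous_on {a..b} ?u"
    by (rule continuous_on_compose2[OF u(1) \<gamma>c ball])
  define P where "P s t \<longleftrightarrow> (a \<le> s \<and> s \<le> t \<and> t \<le> b \<longrightarrow> (\<exists>xs. sorted xs \<and> set xs \<subseteq> {s..t} \<and>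
    integral {s..t} ?u - \<eta> * (t - s) \<le> polygon_sum \<sigma> xs))" for s t
  have "P a b"
    using ab(2)
  proof (induction rule: Bolzano)
    case (trans p q r)
    show ?case unfolding P_def
    proof
      assume *: "a \<le> p \<and> p \<le> r \<and> r \<le> b"
      obtain xs where xs: "sorted xs" "set xs \<subseteq> {p..q}"
        "integral {p..q} ?u - \<eta> * (q - p) \<le> polygon_sum \<sigma> xs"
        using trans * unfolding P_def by auto
      obtain ys where ys: "sorted ys" "set ys \<subseteq> {q..r}"
        "integral {q..r} ?u - \<eta> * (r - q) \<le> polygon_sum \<sigma> ys"
        using trans * unfolding P_def by auto
      have "?u integrable_on {p..r}"
        by (intro integrable_continuous_real continuous_on_subset[OF uc]) (use * in auto)
      then have "integral {p..r} ?u = integral {p..q} ?u + integral {q..r} ?u"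
        by (rule Henstock_Kurzweil_Integration.integral_combine[OF trans(3,4), symmetric])
      then have "integral {p..r} ?u - \<eta> * (r - p) \<le> polygon_sum \<sigma> xs + polygon_sum \<sigma> ys"
        using xs(3) ys(3) by (simp add: algebra_simps)
      also have "\<dots> \<le> polygon_sum \<sigma> (xs @ ys)"
        by (rule polygon_sum_append[OF \<sigma>nn])
      finally have "integral {p..r} ?u - \<eta> * (r - p) \<le> polygon_sum \<sigma> (xs @ ys)" .
      moreover have "sorted (xs @ ys)"
        using xs ys by (auto simp: sorted_append subset_iff) (meson order_trans)
      moreover have "set (xs @ ys) \<subseteq> {p..r}" using xs(2) ys(2) trans(3,4) by auto
      ultimately show "\<exists>xs. sorted xs \<and> set xs \<subseteq> {p..r} \<and>
          integral {p..r} ?u - \<eta> * (r - p) \<le> polygon_sum \<sigma> xs" by blast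
    qed
  next
    case (local x)
    define w0 where "w0 = u (\<gamma> x)"
    have xb: "\<gamma> x \<in> ball 0 1" using ball local by (auto simp: image_subset_iff)
    have w0: "0 \<le> w0" using u(2)[OF xb] by (simp add: w0_def)
    have "isCont u (\<gamma> x)" using u(1) xb by (simp add: continuous_on_eq_continuous_at)
    then obtain d1 where d1: "0 < d1" "\<And>z. dist z (\<gamma> x) < d1 \<Longrightarrow> dist (u z) w0 < \<eta> / 3"
      using \<eta> unfolding continuous_at_eps_delta w0_def by (metis divide_pos_pos zero_less_numeral)
    obtain d2 where d2: "0 < d2" "ball (\<gamma> x) d2 \<subseteq> ball 0 1"
      using xb open_ball openE by blast
    define d where "d = min d1 d2"
    have d: "0 < d" "ball (\<gamma> x) d \<subseteq> ball 0 1"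
      using d1(1) d2 by (auto simp: d_def subset_iff)
    have du: "\<bar>u z - w0\<bar> \<le> \<eta> / 3" if "z \<in> ball (\<gamma> x) d" for z
    proof -
      have "dist z (\<gamma> x) < d1" using that by (simp add: d_def dist_commute)
      from d1(2)[OF this] show ?thesis by (simp add: dist_real_def)
    qed
    have "P s t" if st: "s \<le> x" "x \<le> t" "t - s < d" for s t
      unfolding P_def
    proof
      assume *: "a \<le> s \<and> s \<le> t \<and> t \<le> b"
      show "\<exists>xs. sorted xs \<and> set xs \<subseteq> {s..t} \<and>
          integral {s..t} ?u - \<eta> * (t - s) \<le> polygon_sum \<sigma> xs"
      proof (cases "s = t")
        case True
        then show ?thesis by (intro exI[of _ "[]"]) simp
      next
        case False
        then have lt: "s < t" using * by simp
        have sub: "{s..t} \<subseteq> {a..b}" using * by auto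
        have near: "\<gamma> r \<in> ball (\<gamma> x) d" if "r \<in> {s..t}" for r
        proof -
          have "x \<in> I" "r \<in> I" using that st ab(1) * by (auto simp: subset_iff)
          then have "dist (\<gamma> x) (\<gamma> r) \<le> \<bar>x - r\<bar>"
            by (rule arc_length_parametrized_dist_le[OF \<gamma>])
          then show ?thesis using that st by auto
        qed
        have stI: "s \<in> I" "t \<in> I" using ab(1) * lt by (auto simp: subset_iff)
        \<comment> \<open>The budget \<open>\<eta>\<close> is split in three: the oscillation of
          \<open>u\<close> above and below \<open>w0\<close> costs one third each, the length lost
          by the polygon, weighted with \<open>w0\<close>, the last. The summand 1 guards against
          \<open>w0 = 0\<close>.\<close>
        define \<kappa> where "\<kappa> = (\<eta> / 3) / (w0 + 1)"
        have \<kappa>: "0 < \<kappa>" "w0 * \<kappa> \<le> \<eta> / 3"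
          using \<eta> w0 by (auto simp: \<kappa>_def field_simps)
        obtain xs where xs: "sorted xs" "set xs \<subseteq> {s..t}"
          "t - s - \<kappa> * (t - s) < polygon_sum (\<lambda>s t. dist (\<gamma> s) (\<gamma> t)) xs"
          by (rule arc_length_parametrized_polygon_approx[OF \<gamma> stI lt, of "\<kappa> * (t - s)"])
            (use lt \<kappa> in auto)
        define l where "l = polygon_sum (\<lambda>s t. dist (\<gamma> s) (\<gamma> t)) xs"
        have l: "l \<le> t - s" unfolding l_def
          using lt by (intro arc_length_parametrized_polygon_le[OF \<gamma> stI _ xs(1,2)]) auto
        have up: "integral {s..t} ?u \<le> (w0 + \<eta> / 3) * (t - s)"
        proof -
          have "integral {s..t} ?u \<le> integral {s..t} (\<lambda>r. w0 + \<eta> / 3)"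
          proof (rule integral_le)
            show "?u integrable_on {s..t}"
              by (intro integrable_continuous_real continuous_on_subset[OF uc] sub)
            show "?u r \<le> w0 + \<eta> / 3" if "r \<in> {s..t}" for r
              using du[OF near[OF that]] by linarith
          qed auto
          then show ?thesis using lt by (simp add: mult.commute)
        qed
        have "(w0 - \<eta> / 3) * l = polygon_sum (\<lambda>s t. (w0 - \<eta> / 3) * dist (\<gamma> s) (\<gamma> t)) xs"
          unfolding l_def by (simp add: polygon_sum_mult_left)
        also have "\<dots> \<le> polygon_sum \<sigma> xs"
        proof (rule polygon_sum_mono)
          fix p q assume "p \<in> set xs" "q \<in> set xs"
          then have pq: "p \<in> {s..t}" "q \<in> {s..t}" using xs(2) by auto
          have "(w0 - \<eta> / 3) * dist (\<gamma> p) (\<gamma> q) \<le> segment_integral u (\<gamma> p) (\<gamma> q)"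
          proof (rule segment_integral_ge[OF continuous_on_subset[OF u(1) d(2)] near near])
            show "w0 - \<eta> / 3 \<le> u z" if "z \<in> ball (\<gamma> x) d" for z
              using du[OF that] by linarith
          qed (use pq in auto)
          then show "(w0 - \<eta> / 3) * dist (\<gamma> p) (\<gamma> q) \<le> \<sigma> p q"
            using pq sub by (auto simp: \<sigma>_def)
        qed
        finally have lo: "(w0 - \<eta> / 3) * l \<le> polygon_sum \<sigma> xs" .
        define D where "D = t - s"
        have "w0 * (D - \<kappa> * D) \<le> w0 * l"
          using xs(3) w0 unfolding l_def D_def by (intro mult_left_mono) auto
        then have 1: "w0 * D - w0 * \<kappa> * D \<le> w0 * l" by (simp add: right_diff_distrib mult.assoc)
        have 2: "w0 * \<kappa> * D \<le> \<eta> / 3 * D"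
          using \<kappa>(2) lt unfolding D_def by (intro mult_right_mono) auto
        have 3: "\<eta> / 3 * l \<le> \<eta> / 3 * D"
          using l \<eta> unfolding D_def by (intro mult_left_mono) auto
        have 4: "integral {s..t} ?u \<le> w0 * D + \<eta> / 3 * D"
          using up unfolding D_def[symmetric] distrib_right .
        have 5: "w0 * l - \<eta> / 3 * l \<le> polygon_sum \<sigma> xs"
          using lo unfolding left_diff_distrib .
        have "integral {s..t} ?u - \<eta> * D \<le> polygon_sum \<sigma> xs"
          using 1 2 3 4 5 by linarith
        then have "integral {s..t} ?u - \<eta> * (t - s) \<le> polygon_sum \<sigma> xs"
          unfolding D_def .
        then show ?thesis using xs(1,2) by blast
      qed
    qed
    then show ?case using d(1) by blast
  qed
  then obtain xs where xs: "sorted xs" "set xs \<subseteq> {a..b}"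
    "integral {a..b} ?u - \<eta> * (b - a) \<le> polygon_sum \<sigma> xs"
    using ab(2) unfolding P_def by auto
  moreover have "polygon_sum \<sigma> xs \<le> polygon_sum (\<lambda>s t. segment_integral u (\<gamma> s) (\<gamma> t)) xs"
    by (rule polygon_sum_mono) (use xs(2) in \<open>auto simp: \<sigma>_def\<close>)
  ultimately show ?thesis using that[of xs] by linarith
qed

text \<open>Summing the bounds for the edges leaves, for each point of the circle, the variation of
  its visual angle along the vertices. The angle stays in an interval of length pi and takes all but
  finitely many values at most twice, so the variation is at most 2 pi; the prefactor 1 / pi turns
  this into 2.\<close>

lemma convex_curve_polygon_sum_le:
  fixes h :: "complex \<Rightarrow> complex"
  assumes \<gamma>: "convex_curve \<gamma> I" and ab: "{a..b} \<subseteq> I" and ball: "\<gamma> ` {a..b} \<subseteq> ball 0 1"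
    and c: "continuous_on (cball 0 1) h" and hol: "h holomorphic_on ball 0 1"
    and xs: "sorted xs" "set xs \<subseteq> {a..b}"
  shows "polygon_sum (\<lambda>s t. segment_integral (\<lambda>z. norm (h z)) (\<gamma> s) (\<gamma> t)) xs \<le>
    2 * integral {0..2*pi} (\<lambda>t. norm (h (cis t)))"
proof -
  obtain K where K: "convex K" "\<gamma> ` I \<subseteq> frontier K" and arc: "arc_length_parametrized \<gamma> I"
    and once: "traversed_once \<gamma> I"
    using \<gamma> unfolding convex_curve_def by auto
  \<comment> \<open>A closed curve takes the same value at both ends of its parameter interval, so
    injectivity is claimed on the open interval only.\<close>
  have inj: "inj_on \<gamma> {a<..<b}"
  proof (cases "inj_on \<gamma> I")
    case True
    then show ?thesis by (rule inj_on_subset) (use ab in auto)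
  next
    case False
    then obtain p q where pq: "I = {p..q}" "inj_on \<gamma> {p..<q}"
      using once unfolding traversed_once_def by auto
    have "{a<..<b} \<subseteq> {p..<q}" using ab unfolding pq(1) by (cases "a < b") auto
    then show ?thesis using inj_on_subset pq(2) by blast
  qed
  have \<gamma>c: "continuous_on {a..b} \<gamma>"
    using arc_length_parametrized_continuous[OF arc] ab by (rule continuous_on_subset)
  have in1: "norm (\<gamma> s) < 1" if "s \<in> {a..b}" for s using ball that by (auto simp: image_subset_iff)
  have var: "polygon_sum (\<lambda>s t. \<bar>visual_angle (cis \<theta>) (\<gamma> t) - visual_angle (cis \<theta>) (\<gamma> s)\<bar>) xs \<le> 2 * pi"
    for \<theta>
  proof -
    let ?N = "{x. \<exists>p1 p2 p3. {p1, p2, p3} \<subseteq> frontier K \<inter> ball 0 1 \<and>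
      p1 \<noteq> p2 \<and> p1 \<noteq> p3 \<and> p2 \<noteq> p3 \<and> visual_angle (cis \<theta>) p1 = x \<and>
      visual_angle (cis \<theta>) p2 = x \<and> visual_angle (cis \<theta>) p3 = x}"
    have "polygon_sum (\<lambda>s t. \<bar>visual_angle (cis \<theta>) (\<gamma> t) - visual_angle (cis \<theta>) (\<gamma> s)\<bar>) xs
      \<le> 2 * (pi / 2 - - (pi / 2))"
    proof (rule variation_le_of_multiplicity[where a = a and b = b and N = ?N])
      have "1 - cnj (cis \<theta>) * \<gamma> s \<notin> \<real>\<^sub>\<le>\<^sub>0" if "s \<in> {a..b}" for s
        using one_minus_cnj_mult_not_nonpos[OF in1[OF that], of "cis \<theta>"] by simp
      then show "continuous_on {a..b} (\<lambda>s. visual_angle (cis \<theta>) (\<gamma> s))"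
        unfolding visual_angle_def by (intro continuous_intros \<gamma>c)
      show "visual_angle (cis \<theta>) (\<gamma> s) \<in> {- (pi / 2)..pi / 2}" if "s \<in> {a..b}" for s
        using visual_angle_bounds[OF in1[OF that], of "cis \<theta>"] by auto
      show "finite ?N" by (rule finite_exceptional_angles[OF K(1)]) simp
      fix s1 s2 s3
      assume s: "a < s1" "s1 < s2" "s2 < s3" "s3 < b"
        and eq: "visual_angle (cis \<theta>) (\<gamma> s2) = visual_angle (cis \<theta>) (\<gamma> s1)"
          "visual_angle (cis \<theta>) (\<gamma> s3) = visual_angle (cis \<theta>) (\<gamma> s1)"
      \<comment> \<open>Injectivity makes the three curve points distinct, so a common angle belongs
        to the finite exceptional set.\<close>
      have "\<gamma> s1 \<noteq> \<gamma> s2" "\<gamma> s1 \<noteq> \<gamma> s3" "\<gamma> s2 \<noteq> \<gamma> s3"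
        using inj s by (auto dest!: inj_onD)
      moreover have "{\<gamma> s1, \<gamma> s2, \<gamma> s3} \<subseteq> frontier K \<inter> ball 0 1"
        using K(2) ab ball s by (auto simp: image_subset_iff subset_iff)
      ultimately show "visual_angle (cis \<theta>) (\<gamma> s1) \<in> ?N"
        using eq by blast
    qed (use xs pi_gt_zero in auto)
    then show ?thesis by simp
  qed
  let ?V = "\<lambda>i t. norm (h (cis t)) * \<bar>visual_angle (cis t) (\<gamma> (xs ! Suc i)) - visual_angle (cis t) (\<gamma> (xs ! i))\<bar>"
  have hc: "continuous_on {0..2*pi} (\<lambda>t. h (cis t))"
    by (rule continuous_on_compose2[OF c]) (auto intro!: continuous_intros)
  have Vi: "?V i integrable_on {0..2*pi}" if "i < length xs - 1" for i
  proof -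
    have "xs ! i \<in> set xs" "xs ! Suc i \<in> set xs" using that by auto
    then show ?thesis
      by (intro integrable_continuous_real continuous_intros hc continuous_on_visual_angle in1)
        (use xs(2) in auto)
  qed
  have "polygon_sum (\<lambda>s t. segment_integral (\<lambda>z. norm (h z)) (\<gamma> s) (\<gamma> t)) xs \<le>
    polygon_sum (\<lambda>s t. 1 / pi * integral {0..2*pi}
      (\<lambda>\<theta>. norm (h (cis \<theta>)) * \<bar>visual_angle (cis \<theta>) (\<gamma> t) - visual_angle (cis \<theta>) (\<gamma> s)\<bar>)) xs"
    by (intro polygon_sum_mono segment_integral_le_visual_angle c hol in1) (use xs(2) in auto)
  also have "\<dots> = 1 / pi * (\<Sum>i<length xs - 1. integral {0..2*pi} (?V i))"
    unfolding polygon_sum_mult_left by (simp add: polygon_sum_def)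
  also have "(\<Sum>i<length xs - 1. integral {0..2*pi} (?V i)) =
      integral {0..2*pi} (\<lambda>t. \<Sum>i<length xs - 1. ?V i t)"
    by (rule integral_sum[symmetric]) (use Vi in auto)
  also have "\<dots> \<le> integral {0..2*pi} (\<lambda>t. norm (h (cis t)) * (2 * pi))"
  proof (rule integral_le)
    show "(\<lambda>t. \<Sum>i<length xs - 1. ?V i t) integrable_on {0..2*pi}"
      by (rule integrable_sum) (use Vi in auto)
    show "(\<lambda>t. norm (h (cis t)) * (2 * pi)) integrable_on {0..2*pi}"
      by (intro integrable_continuous_real continuous_intros hc)
    show "(\<Sum>i<length xs - 1. ?V i t) \<le> norm (h (cis t)) * (2 * pi)" for t
      unfolding sum_distrib_left[symmetric]
      by (rule mult_left_mono) (use var[of t] in \<open>auto simp: polygon_sum_def\<close>)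
  qed
  also have "\<dots> = integral {0..2*pi} (\<lambda>t. norm (h (cis t))) * (2 * pi)"
    by (rule integral_mult_left)
  finally show ?thesis by (simp add: field_simps)
qed

lemma nn_integral_continuous_interval:
  fixes \<phi> :: "real \<Rightarrow> real"
  assumes c: "continuous_on {a..b} \<phi>" and nn: "\<And>s. s \<in> {a..b} \<Longrightarrow> 0 \<le> \<phi> s"
  shows "(\<integral>\<^sup>+s\<in>{a..b}. ennreal (\<phi> s) \<partial>lborel) = ennreal (integral {a..b} \<phi>)"
proof -
  have i: "set_integrable lborel {a..b} \<phi>" by (rule borel_integrable_atLeastAtMost'[OF c])
  have "(\<integral>\<^sup>+s\<in>{a..b}. ennreal (\<phi> s) \<partial>lborel) = (\<integral>\<^sup>+s. ennreal (indicator {a..b} s *\<^sub>R \<phi> s) \<partial>lborel)"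
    by (intro nn_integral_cong) (auto simp: indicator_def)
  also have "\<dots> = ennreal (LBINT s:{a..b}. \<phi> s)"
    unfolding set_lebesgue_integral_def
    by (rule nn_integral_eq_integral) (use i nn in \<open>auto simp: set_integrable_def indicator_def\<close>)
  also have "(LBINT s:{a..b}. \<phi> s) = integral {a..b} \<phi>"
    by (rule set_borel_integral_eq_integral(2)[OF i])
  finally show ?thesis .
qed

text \<open>\<open>I\<close> may be open, half-open or unbounded. Its frontier is a null set, and
  its interior is exhausted by compact sets \<open>K n\<close>. These need not be intervals, but the
  interval from \<open>Inf (K n)\<close> to \<open>Sup (K n)\<close> still lies in \<open>I\<close>,
  so monotone convergence carries the uniform bound over.\<close>

lemma nn_integral_interval_le:
  fixes \<phi> :: "real \<Rightarrow> ennreal"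
  assumes I: "is_interval I" and meas: "(\<lambda>s. \<phi> s * indicator I s) \<in> borel_measurable borel"
    and le: "\<And>a b. a \<le> b \<Longrightarrow> {a..b} \<subseteq> I \<Longrightarrow> (\<integral>\<^sup>+s\<in>{a..b}. \<phi> s \<partial>lborel) \<le> C"
  shows "(\<integral>\<^sup>+s\<in>I. \<phi> s \<partial>lborel) \<le> C"
proof -
  obtain K where K: "\<And>n. compact (K n)" "\<And>n. K n \<subseteq> interior I"
    "\<And>n. K n \<subseteq> interior (K (Suc n))" "\<Union>(range K) = interior I"
    by (rule open_Union_compact_subsets[OF open_interior[of I]]) (rule that)
  have inc: "incseq K" by (rule incseq_SucI) (rule subset_trans[OF K(3) interior_subset])
  have fr: "frontier I \<in> null_sets lborel"
  proof -
    have "negligible (frontier I)"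
      by (rule negligible_convex_frontier) (use I in \<open>simp add: is_interval_convex\<close>)
    then show ?thesis by (simp add: negligible_iff_null_sets null_sets_completion_iff)
  qed
  have "(\<integral>\<^sup>+s\<in>I. \<phi> s \<partial>lborel) = (\<integral>\<^sup>+s. (SUP n. \<phi> s * indicator I s * indicator (K n) s) \<partial>lborel)"
  proof (rule nn_integral_cong_AE, rule AE_mp[OF AE_not_in[OF fr]], rule AE_I2, rule impI)
    fix s :: real assume s: "s \<notin> frontier I"
    show "\<phi> s * indicator I s = (SUP n. \<phi> s * indicator I s * indicator (K n) s)"
    proof (cases "s \<in> I")
      case True
      then have "s \<in> interior I" using s closure_subset by (auto simp: frontier_def)
      then obtain n where n: "s \<in> K n" using K(4) by blast
      show ?thesis
      proof (rule antisym)
        show "\<phi> s * indicator I s \<le> (SUP n. \<phi> s * indicator I s * indicator (K n) s)"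
          by (rule SUP_upper2[of n]) (use n in auto)
        show "(SUP n. \<phi> s * indicator I s * indicator (K n) s) \<le> \<phi> s * indicator I s"
          by (rule SUP_least) (auto simp: indicator_def)
      qed
    qed simp
  qed
  also have "\<dots> = (SUP n. \<integral>\<^sup>+s. \<phi> s * indicator I s * indicator (K n) s \<partial>lborel)"
  proof (rule nn_integral_monotone_convergence_SUP)
    show "incseq (\<lambda>n s. \<phi> s * indicator I s * indicator (K n) s)"
      using inc by (auto simp: incseq_def le_fun_def indicator_def)
    show "(\<lambda>s. \<phi> s * indicator I s * indicator (K n) s) \<in> borel_measurable lborel" for n
    proof -
      have [measurable]: "K n \<in> sets borel"
        using compact_imp_closed[OF K(1)[of n]] by (rule borel_closed)
      show ?thesis using meas by measurable
    qed
  qed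
  also have "\<dots> \<le> C"
  proof (rule SUP_least)
    fix n
    show "(\<integral>\<^sup>+s. \<phi> s * indicator I s * indicator (K n) s \<partial>lborel) \<le> C"
    proof (cases "K n = {}")
      case False
      have b: "bdd_below (K n)" "bdd_above (K n)" "closed (K n)"
        using K(1)[of n] by (auto simp: compact_eq_bounded_closed bounded_imp_bdd_below bounded_imp_bdd_above)
      have m: "Inf (K n) \<in> I" "Sup (K n) \<in> I"
        using closed_contains_Inf[OF False b(1,3)] closed_contains_Sup[OF False b(2,3)] K(2)[of n]
          interior_subset by blast+
      have sub: "{Inf (K n)..Sup (K n)} \<subseteq> I"
        using mem_is_interval_1_I[OF I m] by auto
      have "(\<integral>\<^sup>+s. \<phi> s * indicator I s * indicator (K n) s \<partial>lborel) \<le>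
          (\<integral>\<^sup>+s\<in>{Inf (K n)..Sup (K n)}. \<phi> s \<partial>lborel)"
        by (rule nn_integral_mono)
          (use cInf_lower[OF _ b(1)] cSup_upper[OF _ b(2)] in \<open>auto simp: indicator_def\<close>)
      also have "\<dots> \<le> C"
        by (rule le[OF cInf_le_cSup[OF False b(2,1)] sub])
      finally show ?thesis .
    qed simp
  qed
  finally show ?thesis .
qed

lemma continuous_on_interval_indicator_measurable:
  fixes \<phi> :: "real \<Rightarrow> real"
  assumes I: "is_interval I" and c: "continuous_on I \<phi>"
  shows "(\<lambda>s. ennreal (\<phi> s) * indicator I s) \<in> borel_measurable borel"
proof -
  have [measurable]: "I \<in> sets borel"
    using I by (rule real_interval_borel_measurable)
  have "(\<lambda>s. indicator I s *\<^sub>R \<phi> s) \<in> borel_measurable borel"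
    by (rule borel_measurable_continuous_on_indicator[OF _ c]) simp
  then have "(\<lambda>s. ennreal (indicator I s *\<^sub>R \<phi> s)) \<in> borel_measurable borel"
    by measurable
  also have "(\<lambda>s. ennreal (indicator I s *\<^sub>R \<phi> s)) = (\<lambda>s. ennreal (\<phi> s) * indicator I s)"
    by (auto simp: indicator_def fun_eq_iff)
  finally show ?thesis .
qed

text \<open>The bound for inscribed polygons depends neither on the polygon nor on the compact
  parameter interval, so it survives the approximation of the curve integral and the exhaustion of
  \<open>I\<close>.\<close>

lemma gabriel_inequality:
  fixes h :: "complex \<Rightarrow> complex"
  assumes \<gamma>: "convex_curve \<gamma> I" and ball: "\<gamma> ` I \<subseteq> ball 0 1"
    and c: "continuous_on (cball 0 1) h" and hol: "h holomorphic_on ball 0 1"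
  shows "(\<integral>\<^sup>+s\<in>I. ennreal (norm (h (\<gamma> s))) \<partial>lborel) \<le> ennreal (2 * integral {0..2*pi} (\<lambda>t. norm (h (cis t))))"
proof -
  have arc: "arc_length_parametrized \<gamma> I" and I: "is_interval I"
    using \<gamma> by (auto simp: convex_curve_def)
  have hc: "continuous_on (ball 0 1) (\<lambda>z. norm (h z))"
    by (intro continuous_intros continuous_on_subset[OF c]) auto
  have h\<gamma>: "continuous_on I (\<lambda>s. norm (h (\<gamma> s)))"
    by (rule continuous_on_compose2[OF hc arc_length_parametrized_continuous[OF arc] ball])
  show ?thesis
  proof (rule nn_integral_interval_le[OF I continuous_on_interval_indicator_measurable[OF I h\<gamma>]])
    fix a b assume ab: "a \<le> b" "{a..b} \<subseteq> I"
    have ball': "\<gamma> ` {a..b} \<subseteq> ball 0 1" using ball ab(2) by blast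
    have "integral {a..b} (\<lambda>s. norm (h (\<gamma> s))) \<le> 2 * integral {0..2*pi} (\<lambda>t. norm (h (cis t))) + e"
      if e: "0 < e" for e
    proof -
      define \<eta> where "\<eta> = e / (b - a + 1)"
      have \<eta>: "0 < \<eta>" "\<eta> * (b - a) \<le> e" using e ab(1) by (auto simp: \<eta>_def field_simps)
      obtain xs where xs: "sorted xs" "set xs \<subseteq> {a..b}"
        "integral {a..b} (\<lambda>s. norm (h (\<gamma> s))) - \<eta> * (b - a) \<le>
          polygon_sum (\<lambda>s t. segment_integral (\<lambda>z. norm (h z)) (\<gamma> s) (\<gamma> t)) xs"
        by (rule curve_integral_le_polygon_sum[OF arc ab(2,1) ball' hc _ \<eta>(1)]) auto
      show ?thesis
        using convex_curve_polygon_sum_le[OF \<gamma> ab(2) ball' c hol xs(1,2)] xs(3) \<eta>(2) by linarith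
    qed
    then have "integral {a..b} (\<lambda>s. norm (h (\<gamma> s))) \<le> 2 * integral {0..2*pi} (\<lambda>t. norm (h (cis t)))"
      by (rule field_le_epsilon)
    then show "(\<integral>\<^sup>+s\<in>{a..b}. ennreal (norm (h (\<gamma> s))) \<partial>lborel) \<le>
        ennreal (2 * integral {0..2*pi} (\<lambda>t. norm (h (cis t))))"
      using continuous_on_subset[OF h\<gamma> ab(2)]
      by (subst nn_integral_continuous_interval) (auto intro: ennreal_leI)
  qed
qed

section \<open>Powers of functions with positive real part; the Poisson inequality for harmonic
  functions\<close>

lemma kolmogorov_inequality:
  fixes g :: "complex \<Rightarrow> complex"
  assumes c: "continuous_on (cball 0 1) g" and hol: "g holomorphic_on ball 0 1"
    and pos: "\<And>z. z \<in> cball 0 1 \<Longrightarrow> 0 < Re (g z)" and p: "0 < p" "p < 1"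
  obtains h where "continuous_on (cball 0 1) h" "h holomorphic_on ball 0 1"
    "\<And>z. z \<in> cball 0 1 \<Longrightarrow> norm (h z) = norm (g z) powr p"
    "integral {0..2*pi} (\<lambda>t. norm (h (cis t))) \<le> 2 * pi / cos (pi * p / 2) * norm (g 0) powr p"
proof
  \<comment> \<open>The power itself is returned along with its bound, because
    \<open>gabriel_inequality\<close> is later applied to this holomorphic function. Its argument is
    p times that of \<open>g\<close>, hence at most \<open>pi * p / 2\<close> in absolute
    value.\<close>
  define h where "h z = exp (of_real p * Ln (g z))" for z
  have nn: "g z \<notin> \<real>\<^sub>\<le>\<^sub>0" if "z \<in> cball 0 1" for z
    using pos[OF that] complex_nonpos_Reals_iff[of "g z"] by linarith
  have nz: "g z \<noteq> 0" if "z \<in> cball 0 1" for z using pos[OF that] by auto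
  show hc: "continuous_on (cball 0 1) h"
    unfolding h_def using nn by (intro continuous_intros c) auto
  show hh: "h holomorphic_on ball 0 1"
    unfolding h_def using nn by (intro holomorphic_intros hol) auto
  show norm_h: "norm (h z) = norm (g z) powr p" if "z \<in> cball 0 1" for z
    using nz[OF that] by (simp add: h_def powr_def)
  have cp: "0 < cos (pi * p / 2)"
    by (rule cos_gt_zero) (use p in auto)
  have Re_h: "cos (pi * p / 2) * norm (h z) \<le> Re (h z)" if z: "z \<in> cball 0 1" for z
  proof -
    have "\<bar>Im (Ln (g z))\<bar> < pi / 2" using Re_Ln_pos_lt[OF nz[OF z]] pos[OF z] by blast
    then have "p * \<bar>Im (Ln (g z))\<bar> \<le> p * (pi / 2)" using p by (intro mult_left_mono) auto
    then have "\<bar>p * Im (Ln (g z))\<bar> \<le> pi * p / 2" using p by (simp add: abs_mult mult.commute)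
    moreover have "pi * p / 2 \<le> pi" using p by simp
    ultimately have "cos (pi * p / 2) \<le> cos \<bar>p * Im (Ln (g z))\<bar>"
      by (intro cos_monotone_0_pi_le) auto
    then have "cos (pi * p / 2) \<le> cos (p * Im (Ln (g z)))" by simp
    then have "exp (p * Re (Ln (g z))) * cos (pi * p / 2) \<le> exp (p * Re (Ln (g z))) * cos (p * Im (Ln (g z)))"
      by (intro mult_left_mono) auto
    then show ?thesis by (simp add: h_def Re_exp mult.commute)
  qed
  \<comment> \<open>At the centre the Poisson kernel is 1, and the formula becomes the mean value
    property.\<close>
  have I: "((\<lambda>t. Re (h (cis t))) has_integral (2 * pi * Re (h 0))) {0..2*pi}"
    using has_integral_Re[OF poisson_formula_holomorphic[OF hc hh, of 0]] by (simp add: poisson_kernel_def)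
  have hcis: "continuous_on {0..2*pi} (\<lambda>t. h (cis t))"
    by (rule continuous_on_compose2[OF hc]) (auto intro!: continuous_intros)
  have "cos (pi * p / 2) * integral {0..2*pi} (\<lambda>t. norm (h (cis t))) =
      integral {0..2*pi} (\<lambda>t. cos (pi * p / 2) * norm (h (cis t)))"
    by (rule integral_mult_right[symmetric])
  also have "\<dots> \<le> integral {0..2*pi} (\<lambda>t. Re (h (cis t)))"
    by (intro integral_le integrable_continuous_real continuous_intros hcis Re_h) auto
  also have "\<dots> = 2 * pi * Re (h 0)" using I by (rule integral_unique)
  also have "\<dots> \<le> 2 * pi * norm (g 0) powr p"
    using complex_Re_le_cmod[of "h 0"] norm_h[of 0] by (intro mult_left_mono) auto
  finally show "integral {0..2*pi} (\<lambda>t. norm (h (cis t))) \<le> 2 * pi / cos (pi * p / 2) * norm (g 0) powr p"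
    using cp by (simp add: field_simps)
qed

lemma harmonic_on_ball_Re_holomorphic:
  assumes "harmonic_on f (ball 0 1)"
  obtains \<Phi> \<Psi> where "\<Phi> holomorphic_on ball 0 1" "\<Psi> holomorphic_on ball 0 1"
    "\<And>z. z \<in> ball 0 1 \<Longrightarrow> f z = of_real (Re (\<Phi> z)) + \<i> * of_real (Re (\<Psi> z))"
proof -
  have h_Re: "real_harmonic_on (\<lambda>z. Re (f z)) (ball 0 1)"
    and h_Im: "real_harmonic_on (\<lambda>z. Im (f z)) (ball 0 1)"
    using assms by (simp_all add: harmonic_on_def)
  obtain \<Phi> where \<Phi>: "\<Phi> holomorphic_on ball 0 1" "\<And>z. z \<in> ball 0 1 \<Longrightarrow> Re (f z) = Re (\<Phi> z)"
    by (rule real_harmonic_on_imp_Re_holomorphic[OF h_Re open_ball convex_ball]) (rule that)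
  obtain \<Psi> where \<Psi>: "\<Psi> holomorphic_on ball 0 1" "\<And>z. z \<in> ball 0 1 \<Longrightarrow> Im (f z) = Re (\<Psi> z)"
    by (rule real_harmonic_on_imp_Re_holomorphic[OF h_Im open_ball convex_ball]) (rule that)
  show ?thesis by (rule that[OF \<Phi>(1) \<Psi>(1)]) (simp add: complex_eq_iff \<Phi>(2) \<Psi>(2))
qed

lemma harmonic_on_ball_continuous:
  assumes "harmonic_on f (ball 0 1)" shows "continuous_on (ball 0 1) f"
proof -
  obtain \<Phi> \<Psi> where F: "\<Phi> holomorphic_on ball 0 1" "\<Psi> holomorphic_on ball 0 1"
    "\<And>z. z \<in> ball 0 1 \<Longrightarrow> f z = of_real (Re (\<Phi> z)) + \<i> * of_real (Re (\<Psi> z))"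
    by (rule harmonic_on_ball_Re_holomorphic[OF assms]) (rule that)
  have "continuous_on (ball 0 1) (\<lambda>z. of_real (Re (\<Phi> z)) + \<i> * of_real (Re (\<Psi> z)))"
    by (intro continuous_intros holomorphic_on_imp_continuous_on F)
  then show ?thesis by (rule continuous_on_eq) (simp only: F(3))
qed

lemma norm_of_real_mult_less_1: "norm (of_real r * z :: complex) < 1" if "0 \<le> r" "r < 1" "norm z \<le> 1"
proof -
  have "norm (of_real r * z) = r * norm z" using that by (simp add: norm_mult)
  also have "\<dots> \<le> r * 1" using that by (intro mult_left_mono) auto
  finally show ?thesis using that by simp
qed

text \<open>The formulas for the real and the imaginary part are joined into one for
  \<open>f\<close> before the norm is taken, so no constant is lost. The dilation by
  \<open>r\<close> supplies continuity up to the unit circle.\<close>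

lemma poisson_inequality_harmonic:
  assumes f: "harmonic_on f (ball 0 1)" and r: "0 \<le> r" "r < 1" and z: "norm z < 1"
  shows "2 * pi * norm (f (of_real r * z)) \<le>
    integral {0..2*pi} (\<lambda>t. poisson_kernel z (cis t) * norm (f (of_real r * cis t)))"
proof -
  obtain \<Phi> \<Psi> where F: "\<Phi> holomorphic_on ball 0 1" "\<Psi> holomorphic_on ball 0 1"
    "\<And>z. z \<in> ball 0 1 \<Longrightarrow> f z = of_real (Re (\<Phi> z)) + \<i> * of_real (Re (\<Psi> z))"
    by (rule harmonic_on_ball_Re_holomorphic[OF f]) (rule that)
  have in1: "of_real r * w \<in> ball 0 1" if "norm w \<le> 1" for w :: complex
    using norm_of_real_mult_less_1[OF r that] by simp
  have P: "((\<lambda>t. poisson_kernel z (cis t) * Re (H (of_real r * cis t))) has_integral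
      2 * pi * Re (H (of_real r * z))) {0..2*pi}" if H: "H holomorphic_on ball 0 1" for H
  proof -
    have "continuous_on (cball 0 1) (\<lambda>w. H (of_real r * w))"
      by (rule continuous_on_compose2[OF holomorphic_on_imp_continuous_on[OF H]])
        (use in1 in \<open>auto intro!: continuous_intros\<close>)
    moreover have "(\<lambda>w. H (of_real r * w)) holomorphic_on ball 0 1"
      by (rule holomorphic_on_compose_gen[OF _ H, unfolded o_def])
        (use in1 in \<open>auto intro!: holomorphic_intros\<close>)
    ultimately show ?thesis
      using has_integral_Re[OF poisson_formula_holomorphic[of "\<lambda>w. H (of_real r * w)", OF _ _ z]]
      by simp
  qed
  have "((\<lambda>t. of_real (poisson_kernel z (cis t) * Re (\<Phi> (of_real r * cis t))) +
      \<i> * of_real (poisson_kernel z (cis t) * Re (\<Psi> (of_real r * cis t)))) has_integral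
      (of_real (2 * pi * Re (\<Phi> (of_real r * z))) + \<i> * of_real (2 * pi * Re (\<Psi> (of_real r * z))))) {0..2*pi}"
    by (intro has_integral_add has_integral_mult_right has_integral_of_real P F)
  moreover have "of_real (poisson_kernel z (cis t) * Re (\<Phi> (of_real r * cis t))) +
      \<i> * of_real (poisson_kernel z (cis t) * Re (\<Psi> (of_real r * cis t))) =
      of_real (poisson_kernel z (cis t)) * f (of_real r * cis t)" for t
    by (subst F(3)[OF in1]) (auto simp: algebra_simps)
  moreover have "of_real (2 * pi * Re (\<Phi> (of_real r * z))) + \<i> * of_real (2 * pi * Re (\<Psi> (of_real r * z))) =
      of_real (2 * pi) * f (of_real r * z)"
    by (subst F(3)[OF in1]) (use z in \<open>auto simp: algebra_simps\<close>)
  ultimately have I: "((\<lambda>t. of_real (poisson_kernel z (cis t)) * f (of_real r * cis t)) has_integral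
      of_real (2 * pi) * f (of_real r * z)) {0..2*pi}" by simp
  have fc: "continuous_on {0..2*pi} (\<lambda>t. f (of_real r * cis t))"
    by (rule continuous_on_compose2[OF harmonic_on_ball_continuous[OF f]])
      (use in1 in \<open>auto intro!: continuous_intros\<close>)
  have "2 * pi * norm (f (of_real r * z)) = norm (of_real (2 * pi) * f (of_real r * z))"
    by (simp add: norm_mult)
  also have "\<dots> = norm (integral {0..2*pi} (\<lambda>t. of_real (poisson_kernel z (cis t)) * f (of_real r * cis t)))"
    using integral_unique[OF I] by simp
  also have "\<dots> \<le> integral {0..2*pi} (\<lambda>t. poisson_kernel z (cis t) * norm (f (of_real r * cis t)))"
    by (rule integral_norm_bound_integral)
      (auto intro!: integrable_continuous_real continuous_intros fc continuous_on_poisson_kernel z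
        simp: norm_mult poisson_kernel_nonneg[OF z])
  finally show ?thesis .
qed

subsection \<open>Harmonic functions of class \<open>h1\<close>\<close>

lemma circle_continuous:
  assumes f: "continuous_on (ball 0 1) f" and r: "0 \<le> r" "r < 1"
  shows "continuous_on A (\<lambda>t. f (of_real r * cis t))"
proof (rule continuous_on_compose2[OF f])
  show "continuous_on A (\<lambda>t. of_real r * cis t)" by (intro continuous_intros)
  show "(\<lambda>t. of_real r * cis t) ` A \<subseteq> ball 0 1"
    using norm_of_real_mult_less_1[OF r, of "cis _"] by auto
qed

lemma circle_mean_eq_integral:
  assumes f: "continuous_on (ball 0 1) f" and r: "0 \<le> r" "r < 1"
  shows "circle_mean f r = 1 / (2 * pi) * integral {0..2*pi} (\<lambda>t. norm (f (of_real r * cis t)))"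
  unfolding circle_mean_def
  by (subst set_borel_integral_eq_integral(2))
    (auto intro!: borel_integrable_atLeastAtMost' continuous_intros circle_continuous[OF f r])

lemma circle_mean_nonneg: "0 \<le> circle_mean f r"
  unfolding circle_mean_def set_lebesgue_integral_def
  by (intro mult_nonneg_nonneg integral_nonneg_AE) auto

text \<open>For |w| = 1 the real part of \<open>(w + z) / (w - z)\<close> is the Poisson kernel. No
  factor 1 / (2 pi) is included, so the value at 0 is the full integral of \<open>u\<close>.\<close>

lemma herglotz_transform:
  fixes u :: "real \<Rightarrow> real"
  assumes u: "continuous_on {0..2*pi} u"
  defines "F \<equiv> \<lambda>z. integral {0..2*pi} (\<lambda>t. (cis t + z) / (cis t - z) * of_real (u t))"
  shows "F holomorphic_on ball 0 1"
    and "\<And>z. norm z < 1 \<Longrightarrow> Re (F z) = integral {0..2*pi} (\<lambda>t. poisson_kernel z (cis t) * u t)"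
    and "F 0 = of_real (integral {0..2*pi} u)"
proof -
  have ci: "continuous_on {0..2*pi} (\<lambda>t. (cis t + z) / (cis t - z) * of_real (u t))"
    if "norm z < 1" for z
    using cis_diff_nonzero[OF that] by (intro continuous_intros u) auto
  have nz: "cis t - z \<noteq> 0" if "z \<in> ball 0 1" for t z
    using cis_diff_nonzero that by simp
  have "(\<lambda>z. integral (cbox 0 (2*pi)) (\<lambda>t. (cis t + z) / (cis t - z) * of_real (u t)))
      holomorphic_on ball 0 1"
  proof (rule leibniz_rule_holomorphic)
    fix z :: complex and t assume "z \<in> ball 0 1"
    then have "cis t - z \<noteq> 0" by (rule nz)
    then show "((\<lambda>z. (cis t + z) / (cis t - z) * of_real (u t)) has_field_derivative
        (2 * cis t / (cis t - z)\<^sup>2 * of_real (u t))) (at z within ball 0 1)"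
      by (auto intro!: derivative_eq_intros simp: power2_eq_square divide_simps)
        (simp_all add: algebra_simps)
  next
    fix z :: complex assume "z \<in> ball 0 1"
    then show "(\<lambda>t. (cis t + z) / (cis t - z) * of_real (u t)) integrable_on cbox 0 (2*pi)"
      using integrable_continuous_real[OF ci[of z]] by simp
  next
    have "continuous_on (ball 0 1 \<times> {0..2*pi}) (\<lambda>x :: complex \<times> real. u (snd x))"
      by (rule continuous_on_compose2[OF u]) (auto intro!: continuous_intros)
    then show "continuous_on (ball 0 1 \<times> cbox 0 (2*pi))
        (\<lambda>(z, t). 2 * cis t / (cis t - z)\<^sup>2 * of_real (u t))"
      unfolding split_beta by (intro continuous_intros) (use nz in auto)
  qed simp
  then show "F holomorphic_on ball 0 1" by (simp add: F_def)
  show "Re (F z) = integral {0..2*pi} (\<lambda>t. poisson_kernel z (cis t) * u t)" if z: "norm z < 1" for z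
  proof -
    have "((\<lambda>t. Re ((cis t + z) / (cis t - z) * of_real (u t))) has_integral Re (F z)) {0..2*pi}"
      unfolding F_def by (intro has_integral_Re integrable_integral integrable_continuous_real ci z)
    moreover have "Re ((cis t + z) / (cis t - z) * of_real (u t)) = poisson_kernel z (cis t) * u t" for t
    proof -
      have "Re ((cis t + z) * cnj (cis t - z)) = (cos t)\<^sup>2 + (sin t)\<^sup>2 - (norm z)\<^sup>2"
        unfolding cmod_power2 by (simp add: algebra_simps power2_eq_square)
      also have "\<dots> = 1 - (norm z)\<^sup>2" by simp
      finally have num: "Re ((cis t + z) * cnj (cis t - z)) = 1 - (norm z)\<^sup>2" .
      have "(cis t + z) / (cis t - z) = (cis t + z) * cnj (cis t - z) / of_real ((norm (cis t - z))\<^sup>2)"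
        by (simp add: complex_div_cnj[of "cis t + z"])
      then have "Re ((cis t + z) / (cis t - z)) = poisson_kernel z (cis t)"
        by (simp only: Re_divide_of_real num poisson_kernel_def)
      then show ?thesis
        by (simp only: times_complex.sel Re_complex_of_real Im_complex_of_real mult_zero_right diff_0_right)
    qed
    ultimately show ?thesis by (simp only: integral_unique)
  qed
  have "((\<lambda>t. of_real (u t)) has_integral (of_real (integral {0..2*pi} u) :: complex)) {0..2*pi}"
    by (intro has_integral_of_real integrable_integral integrable_continuous_real u)
  then show "F 0 = of_real (integral {0..2*pi} u)"
    unfolding F_def by (simp add: integral_unique)
qed

text \<open>The radius enters twice. One dilation gives continuous boundary data to the Herglotz
  transform \<open>F\<close>; the other makes \<open>F (r z)\<close> continuous on the closed disc.
  Adding \<open>e\<close> keeps the real part strictly positive even where \<open>f\<close>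
  vanishes.\<close>

lemma convex_curve_integral_dilated_le:
  assumes f: "harmonic_on f (ball 0 1)" and \<gamma>: "convex_curve \<gamma> I" and ball: "\<gamma> ` I \<subseteq> ball 0 1"
    and p: "0 < p" "p < 1" and r: "0 < r" "r < 1" and e: "0 < e"
  shows "(\<integral>\<^sup>+s\<in>I. ennreal (norm (f (of_real r * (of_real r * \<gamma> s))) powr p) \<partial>lborel) \<le>
    ennreal (4 * pi / cos (pi * p / 2) * (circle_mean f r + e) powr p)"
proof -
  define u where "u t = norm (f (of_real r * cis t))" for t
  have fc: "continuous_on (ball 0 1) f" by (rule harmonic_on_ball_continuous[OF f])
  have uc: "continuous_on {0..2*pi} u"
    unfolding u_def using r by (intro continuous_intros circle_continuous[OF fc]) auto
  define F where "F z = integral {0..2*pi} (\<lambda>t. (cis t + z) / (cis t - z) * of_real (u t))" for z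
  note F = herglotz_transform[OF uc, folded F_def]
  define g where "g z = of_real (1 / (2 * pi)) * F (of_real r * z) + of_real e" for z
  have in1: "norm (of_real r * z :: complex) < 1" if "norm z \<le> 1" for z
    using norm_of_real_mult_less_1[of r z] r that by simp
  have Re_g: "norm (f (of_real r * (of_real r * z))) + e \<le> Re (g z)" if z: "norm z \<le> 1" for z
  proof -
    have "2 * pi * norm (f (of_real r * (of_real r * z))) \<le> Re (F (of_real r * z))"
      unfolding F(2)[OF in1[OF z]] u_def
      by (rule poisson_inequality_harmonic[OF f _ _ in1[OF z]]) (use r in auto)
    then show ?thesis by (simp add: g_def field_simps)
  qed
  have Fr: "continuous_on (cball 0 1) (\<lambda>z. F (of_real r * z))"
    by (rule continuous_on_compose2[OF holomorphic_on_imp_continuous_on[OF F(1)]])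
      (use in1 in \<open>auto intro!: continuous_intros\<close>)
  have Fh: "(\<lambda>z. F (of_real r * z)) holomorphic_on ball 0 1"
    by (rule holomorphic_on_compose_gen[OF _ F(1), unfolded o_def])
      (use in1 in \<open>auto intro!: holomorphic_intros\<close>)
  have gc: "continuous_on (cball 0 1) g" unfolding g_def by (intro continuous_intros Fr)
  have gh: "g holomorphic_on ball 0 1" unfolding g_def by (intro holomorphic_intros Fh)
  have gpos: "0 < Re (g z)" if "z \<in> cball 0 1" for z
  proof -
    have "norm (f (of_real r * (of_real r * z))) + e \<le> Re (g z)" using that by (intro Re_g) simp
    moreover have "0 \<le> norm (f (of_real r * (of_real r * z)))" by (rule norm_ge_zero)
    ultimately show ?thesis using e by linarith
  qed
  obtain h where h: "continuous_on (cball 0 1) h" "h holomorphic_on ball 0 1"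
    "\<And>z. z \<in> cball 0 1 \<Longrightarrow> norm (h z) = norm (g z) powr p"
    "integral {0..2*pi} (\<lambda>t. norm (h (cis t))) \<le> 2 * pi / cos (pi * p / 2) * norm (g 0) powr p"
    by (rule kolmogorov_inequality[OF gc gh gpos p]) (assumption, rule that)
  \<comment> \<open>Here the mean of |f| enters: the majorant at the centre is the average of its
    boundary data, plus \<open>e\<close>.\<close>
  have "g 0 = of_real (circle_mean f r + e)"
    using circle_mean_eq_integral[OF fc, of r] r F(3) by (simp add: g_def u_def[abs_def])
  moreover have "0 \<le> circle_mean f r" by (rule circle_mean_nonneg)
  ultimately have g0: "norm (g 0) = circle_mean f r + e"
    using e by (simp only: norm_of_real)
  have "(\<integral>\<^sup>+s\<in>I. ennreal (norm (f (of_real r * (of_real r * \<gamma> s))) powr p) \<partial>lborel) \<le>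
      (\<integral>\<^sup>+s\<in>I. ennreal (norm (h (\<gamma> s))) \<partial>lborel)"
  proof (rule nn_integral_mono)
    fix s
    show "ennreal (norm (f (of_real r * (of_real r * \<gamma> s))) powr p) * indicator I s \<le>
        ennreal (norm (h (\<gamma> s))) * indicator I s"
    proof (cases "s \<in> I")
      case True
      then have s: "norm (\<gamma> s) < 1" using ball by (auto simp: image_subset_iff)
      have "norm (f (of_real r * (of_real r * \<gamma> s))) \<le> norm (g (\<gamma> s))"
        using Re_g[of "\<gamma> s"] complex_Re_le_cmod[of "g (\<gamma> s)"] e s by linarith
      then have "norm (f (of_real r * (of_real r * \<gamma> s))) powr p \<le> norm (h (\<gamma> s))"
        using s p by (subst h(3)) (auto intro: powr_mono2)
      then show ?thesis using True by (simp add: ennreal_leI)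
    qed simp
  qed
  also have "\<dots> \<le> ennreal (2 * integral {0..2*pi} (\<lambda>t. norm (h (cis t))))"
    by (rule gabriel_inequality[OF \<gamma> ball h(1,2)])
  also have "\<dots> \<le> ennreal (4 * pi / cos (pi * p / 2) * (circle_mean f r + e) powr p)"
    using h(4) unfolding g0 by (intro ennreal_leI) simp
  finally show ?thesis .
qed

lemma h1_norm_nonneg:
  assumes "f \<in> h1" shows "0 \<le> h1_norm f"
proof -
  have "0 \<le> circle_mean f (1/2)" by (rule circle_mean_nonneg)
  also have "\<dots> \<le> h1_norm f"
    unfolding h1_norm_def by (rule cSUP_upper) (use assms in \<open>auto simp: h1_def\<close>)
  finally show ?thesis .
qed

text \<open>A curve such as a diameter runs up to the unit circle, where \<open>f\<close> may be
  unbounded, so no dominating function is at hand. Fatou's lemma handles the limit of the dilates,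
  and \<open>e\<close> tends to 0 afterwards.\<close>

lemma convex_curve_integral_le_h1_norm:
  assumes f: "f \<in> h1" and \<gamma>: "convex_curve \<gamma> I" and ball: "\<gamma> ` I \<subseteq> ball 0 1"
    and p: "0 < p" "p < 1"
  shows "arc_length_integral \<gamma> I (\<lambda>z. norm (f z) powr p) \<le>
    ennreal (4 * pi / cos (pi * p / 2) * h1_norm f powr p)"
proof -
  have har: "harmonic_on f (ball 0 1)" and bdd: "bdd_above (circle_mean f ` {0<..<1})"
    using f by (auto simp: h1_def)
  have fc: "continuous_on (ball 0 1) f" by (rule harmonic_on_ball_continuous[OF har])
  have arc: "arc_length_parametrized \<gamma> I" and I: "is_interval I"
    using \<gamma> by (auto simp: convex_curve_def)
  have \<gamma>c: "continuous_on I \<gamma>" by (rule arc_length_parametrized_continuous[OF arc])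
  have cp: "0 < cos (pi * p / 2)"
    by (rule cos_gt_zero) (use p in auto)
  \<comment> \<open>The summand 2 gives \<open>r 0 = 1/2\<close>, so all radii are strictly between
    0 and 1.\<close>
  define r where "r n = 1 - 1 / (real n + 2)" for n
  have r: "0 < r n" "r n < 1" for n by (auto simp: r_def field_simps)
  have r1: "r \<longlonglongrightarrow> 1" unfolding r_def by real_asymp
  define \<phi> where "\<phi> n s = ennreal (norm (f (of_real (r n) * (of_real (r n) * \<gamma> s))) powr p) * indicator I s" for n s
  have in1: "of_real (r n) * (of_real (r n) * \<gamma> s) \<in> ball 0 1" if "s \<in> I" for n s
  proof -
    have "norm (\<gamma> s) \<le> 1" using ball that by (auto simp: image_subset_iff less_imp_le)
    then have "norm (of_real (r n) * \<gamma> s) \<le> 1"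
      using norm_of_real_mult_less_1[of "r n" "\<gamma> s"] r[of n] by simp
    then show ?thesis
      using norm_of_real_mult_less_1[of "r n" "of_real (r n) * \<gamma> s"] r[of n] by simp
  qed
  have meas: "\<phi> n \<in> borel_measurable lborel" for n
  proof -
    have "continuous_on I (\<lambda>s. f (of_real (r n) * (of_real (r n) * \<gamma> s)))"
      by (rule continuous_on_compose2[OF fc])
        (use in1 in \<open>auto intro!: continuous_intros \<gamma>c simp del: mem_ball_0\<close>)
    then have "continuous_on I (\<lambda>s. norm (f (of_real (r n) * (of_real (r n) * \<gamma> s))) powr p)"
      using p by (intro continuous_on_powr' continuous_intros) auto
    from continuous_on_interval_indicator_measurable[OF I this]
    show ?thesis by (simp add: \<phi>_def[abs_def])
  qed
  have lim: "(\<lambda>n. \<phi> n s) \<longlonglongrightarrow> ennreal (norm (f (\<gamma> s)) powr p) * indicator I s" for s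
  proof (cases "s \<in> I")
    case True
    then have s: "\<gamma> s \<in> ball 0 1" using ball by blast
    have "(\<lambda>n. of_real (r n) * (of_real (r n) * \<gamma> s)) \<longlonglongrightarrow> of_real 1 * (of_real 1 * \<gamma> s)"
      by (intro tendsto_intros r1)
    then have "(\<lambda>n. of_real (r n) * (of_real (r n) * \<gamma> s)) \<longlonglongrightarrow> \<gamma> s" by simp
    moreover have "isCont f (\<gamma> s)" using fc s by (simp add: continuous_on_eq_continuous_at)
    ultimately have "(\<lambda>n. f (of_real (r n) * (of_real (r n) * \<gamma> s))) \<longlonglongrightarrow> f (\<gamma> s)"
      by (rule isCont_tendsto_compose[rotated])
    then have "(\<lambda>n. norm (f (of_real (r n) * (of_real (r n) * \<gamma> s))) powr p) \<longlonglongrightarrow> norm (f (\<gamma> s)) powr p"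
      using p by (intro tendsto_powr' tendsto_norm tendsto_const) auto
    then show ?thesis using True by (simp add: \<phi>_def tendsto_ennrealI)
  qed (simp add: \<phi>_def)
  have bound: "arc_length_integral \<gamma> I (\<lambda>z. norm (f z) powr p) \<le>
      ennreal (4 * pi / cos (pi * p / 2) * (h1_norm f + e) powr p)" if e: "0 < e" for e
  proof -
    have "arc_length_integral \<gamma> I (\<lambda>z. norm (f z) powr p) = (\<integral>\<^sup>+s. liminf (\<lambda>n. \<phi> n s) \<partial>lborel)"
      unfolding arc_length_integral_def
      by (intro nn_integral_cong lim_imp_Liminf[OF _ lim, symmetric]) simp
    also have "\<dots> \<le> liminf (\<lambda>n. \<integral>\<^sup>+s. \<phi> n s \<partial>lborel)"
      by (rule nn_integral_liminf) (rule meas)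
    also have "\<dots> \<le> ennreal (4 * pi / cos (pi * p / 2) * (h1_norm f + e) powr p)"
    proof (rule Liminf_le)
      have "(\<integral>\<^sup>+s. \<phi> n s \<partial>lborel) \<le> ennreal (4 * pi / cos (pi * p / 2) * (h1_norm f + e) powr p)" for n
      proof -
        have "(\<integral>\<^sup>+s. \<phi> n s \<partial>lborel) \<le>
            ennreal (4 * pi / cos (pi * p / 2) * (circle_mean f (r n) + e) powr p)"
          unfolding \<phi>_def by (rule convex_curve_integral_dilated_le[OF har \<gamma> ball p r e])
        also have "\<dots> \<le> ennreal (4 * pi / cos (pi * p / 2) * (h1_norm f + e) powr p)"
        proof (intro ennreal_leI mult_left_mono powr_mono2 add_right_mono)
          show "circle_mean f (r n) \<le> h1_norm f"
            unfolding h1_norm_def by (rule cSUP_upper[OF _ bdd]) (use r in auto)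
          show "0 \<le> circle_mean f (r n) + e" using circle_mean_nonneg[of f "r n"] e by simp
        qed (use p cp in auto)
        finally show ?thesis .
      qed
      then show "\<forall>\<^sub>F n in sequentially. (\<integral>\<^sup>+s. \<phi> n s \<partial>lborel) \<le>
          ennreal (4 * pi / cos (pi * p / 2) * (h1_norm f + e) powr p)" by simp
    qed simp
    finally show ?thesis .
  qed
  have "((\<lambda>e. 4 * pi / cos (pi * p / 2) * (h1_norm f + e) powr p) \<longlongrightarrow>
      4 * pi / cos (pi * p / 2) * (h1_norm f + 0) powr p) (at_right 0)"
  proof (intro tendsto_mult_left tendsto_powr' tendsto_add tendsto_const tendsto_ident_at)
    have "\<forall>\<^sub>F e in at_right (0::real). 0 < e" by (rule eventually_at_right_less)
    then have "\<forall>\<^sub>F e in at_right (0::real). 0 \<le> h1_norm f + e"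
      by eventually_elim (use h1_norm_nonneg[OF f] in simp)
    then show "h1_norm f + 0 \<noteq> 0 \<or> 0 < p \<and> (\<forall>\<^sub>F e in at_right 0. 0 \<le> h1_norm f + e)"
      using p by simp
  qed
  then have "((\<lambda>e. ennreal (4 * pi / cos (pi * p / 2) * (h1_norm f + e) powr p)) \<longlongrightarrow>
      ennreal (4 * pi / cos (pi * p / 2) * h1_norm f powr p)) (at_right 0)"
    by (intro tendsto_ennrealI) simp
  then show ?thesis
    by (rule tendsto_lowerbound)
      (use bound in \<open>auto intro: eventually_mono[OF eventually_at_right_less]\<close>)
qed

text \<open>The factor \<open>(2 * pi) powr (1 - p)\<close> is the one that turns
  \<open>(2 * pi * N) powr p\<close> into \<open>2 * pi * N powr p\<close>. The secant summand of
  \<open>A_const\<close> then reproduces the left-hand side, and the other summand contributes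
  \<open>4 * pi * N powr p\<close>.\<close>

lemma A_const_bound:
  assumes p: "0 < p" "p < 1" and N: "0 \<le> N"
  shows "4 * pi / cos (pi * p / 2) * N powr p \<le> A_const p * (2 * pi * N) powr p"
proof -
  have "(2 * pi) powr (1 - p) * (2 * pi * N) powr p = (2 * pi) powr (1 - p) * (2 * pi) powr p * N powr p"
    using N by (simp add: powr_mult)
  also have "(2 * pi) powr (1 - p) * (2 * pi) powr p = 2 * pi"
    by (simp add: powr_add[symmetric])
  finally have *: "(2 * pi) powr (1 - p) * (2 * pi * N) powr p = 2 * pi * N powr p" .
  have "A_const p * (2 * pi * N) powr p =
      2 * (1 + 1 / cos (pi * p / 2)) * ((2 * pi) powr (1 - p) * (2 * pi * N) powr p)"
    by (simp add: A_const_def)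
  also have "\<dots> = 4 * pi / cos (pi * p / 2) * N powr p + 4 * pi * N powr p"
    unfolding * by (simp add: algebra_simps)
  finally show ?thesis by simp
qed

lemma A_const_nonneg:
  assumes "0 < p" "p < 1" shows "0 \<le> A_const p"
proof -
  have "0 < cos (pi * p / 2)" by (rule cos_gt_zero) (use assms in auto)
  then show ?thesis by (simp add: A_const_def)
qed

section \<open>Circle means and the boundary integral\<close>

lemma poisson_kernel_circle:
  "poisson_kernel (of_real r * cis \<theta>) (cis t) = (1 - r\<^sup>2) / (1 + r\<^sup>2 - 2 * r * cos (t - \<theta>))"
proof -
  have expand: "(a - r * b)\<^sup>2 + (c - r * d)\<^sup>2 = (a\<^sup>2 + c\<^sup>2) + r\<^sup>2 * (b\<^sup>2 + d\<^sup>2) - 2 * r * (a * b + c * d)"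
    for a b c d :: real
    by (simp add: power2_eq_square algebra_simps)
  have "(norm (cis t - of_real r * cis \<theta>))\<^sup>2 = (cos t - r * cos \<theta>)\<^sup>2 + (sin t - r * sin \<theta>)\<^sup>2"
    by (simp add: cmod_power2)
  also have "\<dots> = 1 + r\<^sup>2 - 2 * r * cos (t - \<theta>)"
    unfolding expand cos_diff by simp
  finally have "(norm (cis t - of_real r * cis \<theta>))\<^sup>2 = 1 + r\<^sup>2 - 2 * r * cos (t - \<theta>)" .
  then show ?thesis by (simp add: poisson_kernel_def norm_mult power_mult_distrib)
qed

text \<open>Averaging against the Poisson kernel does not increase the L1 norm: by Tonelli's theorem
  the kernel is integrated over the angle of the inner point, and this integral is again 2
  pi.\<close>

lemma circle_mean_le_boundary_integral:
  assumes f: "continuous_on (ball 0 1) f" and P: "poisson_integral_of_radial_limits f"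
    and r: "0 < r" "r < 1"
  shows "2 * pi * circle_mean f r \<le> boundary_integral f"
proof -
  let ?T = "{0..2*pi}"
  define \<phi> where "\<phi> = radial_limit f"
  have \<phi>: "set_integrable lborel ?T \<phi>"
    and rep: "\<And>z. z \<in> ball 0 1 \<Longrightarrow> f z = 1 / (2 * pi) *
      (LBINT t:?T. of_real (poisson_kernel z (cis t)) * \<phi> t)"
    using P by (auto simp: poisson_integral_of_radial_limits_def \<phi>_def poisson_kernel_def)
  have z1: "norm (of_real r * cis \<theta> :: complex) < 1" for \<theta>
    using norm_of_real_mult_less_1[of r "cis \<theta>"] r by simp
  define k where "k \<theta> t = poisson_kernel (of_real r * cis \<theta>) (cis t)" for \<theta> t
  have k_nn: "0 \<le> k \<theta> t" for \<theta> t unfolding k_def by (rule poisson_kernel_nonneg[OF z1])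
  \<comment> \<open>For a fixed radius the kernel depends only on \<open>cos (t - \<theta>)\<close>.
    The symmetry moves the known integral over the boundary angle to the other variable.\<close>
  have k_sym: "k \<theta> t = k t \<theta>" for \<theta> t
    unfolding k_def poisson_kernel_circle using cos_minus[of "t - \<theta>"] by simp
  have k_cont: "continuous_on A (\<lambda>t. k \<theta> t)" for A \<theta>
    unfolding k_def by (rule continuous_on_poisson_kernel[OF z1])
  have k_int: "(\<integral>\<^sup>+\<theta>\<in>?T. ennreal (k \<theta> t) \<partial>lborel) = ennreal (2 * pi)" for t
  proof -
    have "(\<integral>\<^sup>+\<theta>\<in>?T. ennreal (k t \<theta>) \<partial>lborel) = ennreal (integral ?T (k t))"
      by (rule nn_integral_continuous_interval) (auto intro: k_cont k_nn)
    also have "integral ?T (k t) = 2 * pi"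
      unfolding k_def by (rule integral_unique[OF poisson_kernel_has_integral[OF z1]])
    finally show ?thesis by (simp only: k_sym[of _ t])
  qed
  have [measurable]: "(\<lambda>x. k (fst x) (snd x)) \<in> borel_measurable (lborel \<Otimes>\<^sub>M lborel)"
    unfolding k_def poisson_kernel_circle by measurable
  define \<psi> where "\<psi> t = norm (indicator ?T t *\<^sub>R \<phi> t)" for t
  have "(\<lambda>t. indicator ?T t *\<^sub>R \<phi> t) \<in> borel_measurable borel"
    using borel_measurable_integrable[OF \<phi>[unfolded set_integrable_def]] by simp
  then have [measurable]: "\<psi> \<in> borel_measurable borel"
    unfolding \<psi>_def[abs_def] by measurable
  have \<psi>_int: "(\<integral>\<^sup>+t. ennreal (\<psi> t) \<partial>lborel) = ennreal (boundary_integral f)"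
  proof -
    have "(\<integral>\<^sup>+t. ennreal (\<psi> t) \<partial>lborel) = ennreal (\<integral>t. \<psi> t \<partial>lborel)"
      unfolding \<psi>_def
      by (rule nn_integral_eq_integral[OF integrable_norm[OF \<phi>[unfolded set_integrable_def]]]) simp
    also have "(\<integral>t. \<psi> t \<partial>lborel) = boundary_integral f"
      unfolding boundary_integral_def set_lebesgue_integral_def \<psi>_def \<phi>_def
      by (intro Bochner_Integration.integral_cong) auto
    finally show ?thesis .
  qed
  have pt: "ennreal (2 * pi * norm (f (of_real r * cis \<theta>))) \<le> (\<integral>\<^sup>+t. ennreal (k \<theta> t * \<psi> t) \<partial>lborel)" for \<theta>
  proof -
    let ?G = "\<lambda>t. indicator ?T t *\<^sub>R (of_real (k \<theta> t) * \<phi> t)"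
    have "f (of_real r * cis \<theta>) = 1 / (2 * pi) * (\<integral>t. ?G t \<partial>lborel)"
      using rep[of "of_real r * cis \<theta>"] z1[of \<theta>] by (simp add: k_def set_lebesgue_integral_def)
    then have "2 * pi * norm (f (of_real r * cis \<theta>)) = norm (\<integral>t. ?G t \<partial>lborel)"
      by (simp add: norm_mult norm_divide)
    also have "ennreal (norm (\<integral>t. ?G t \<partial>lborel)) \<le> (\<integral>\<^sup>+t. ennreal (norm (?G t)) \<partial>lborel)"
    \<comment> \<open>The Bochner integral of a non-integrable function has the default value 0,
      which settles the second case.\<close>
    proof (cases "integrable lborel ?G")
      case True
      then show ?thesis by (rule integral_norm_bound_ennreal)
    qed (simp add: not_integrable_integral_eq)
    also have "(\<lambda>t. norm (?G t)) = (\<lambda>t. k \<theta> t * \<psi> t)"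
      using k_nn by (auto simp: fun_eq_iff \<psi>_def norm_mult)
    finally show ?thesis .
  qed
  have "ennreal (2 * pi * (2 * pi * circle_mean f r)) =
      ennreal (integral ?T (\<lambda>\<theta>. 2 * pi * norm (f (of_real r * cis \<theta>))))"
    using circle_mean_eq_integral[OF f, of r] r by simp
  also have "\<dots> = (\<integral>\<^sup>+\<theta>\<in>?T. ennreal (2 * pi * norm (f (of_real r * cis \<theta>))) \<partial>lborel)"
    using r by (intro nn_integral_continuous_interval[symmetric] continuous_intros circle_continuous[OF f]) auto
  also have "\<dots> \<le> (\<integral>\<^sup>+\<theta>. (\<integral>\<^sup>+t. ennreal (k \<theta> t * \<psi> t) * indicator ?T \<theta> \<partial>lborel) \<partial>lborel)"
    by (rule nn_integral_mono) (use pt in \<open>auto simp: indicator_def\<close>)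
  also have "\<dots> = (\<integral>\<^sup>+t. (\<integral>\<^sup>+\<theta>. ennreal (k \<theta> t * \<psi> t) * indicator ?T \<theta> \<partial>lborel) \<partial>lborel)"
    by (rule lborel_pair.Fubini'[symmetric]) (simp add: split_beta, measurable)
  also have "\<dots> = (\<integral>\<^sup>+t. ennreal (\<psi> t) * ennreal (2 * pi) \<partial>lborel)"
  proof (rule nn_integral_cong)
    fix t
    have "(\<lambda>\<theta>. k \<theta> t) \<in> borel_measurable borel"
      using borel_measurable_continuous_onI[OF k_cont[of UNIV t]] by (simp only: k_sym[of _ t])
    then have [measurable]: "(\<lambda>\<theta>. k \<theta> t) \<in> borel_measurable lborel" by simp
    have "(\<integral>\<^sup>+\<theta>. ennreal (k \<theta> t * \<psi> t) * indicator ?T \<theta> \<partial>lborel) =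
        (\<integral>\<^sup>+\<theta>. ennreal (\<psi> t) * (ennreal (k \<theta> t) * indicator ?T \<theta>) \<partial>lborel)"
      using k_nn by (intro nn_integral_cong) (simp add: ennreal_mult' \<psi>_def mult_ac)
    also have "\<dots> = ennreal (\<psi> t) * ennreal (2 * pi)"
      by (subst nn_integral_cmult) (auto simp: k_int)
    finally show "(\<integral>\<^sup>+\<theta>. ennreal (k \<theta> t * \<psi> t) * indicator ?T \<theta> \<partial>lborel) = ennreal (\<psi> t) * ennreal (2 * pi)" .
  qed
  also have "\<dots> = ennreal (boundary_integral f) * ennreal (2 * pi)"
    by (subst nn_integral_multc) (auto simp: \<psi>_int)
  also have "\<dots> = ennreal (2 * pi * boundary_integral f)"
    unfolding mult.commute[of "ennreal (boundary_integral f)"] by (rule ennreal_mult'[symmetric]) simp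
  finally have "2 * pi * (2 * pi * circle_mean f r) \<le> 2 * pi * boundary_integral f"
  proof (subst (asm) ennreal_le_iff)
    show "0 \<le> 2 * pi * boundary_integral f"
      unfolding boundary_integral_def set_lebesgue_integral_def
      by (intro mult_nonneg_nonneg integral_nonneg_AE) auto
  qed
  then show ?thesis by simp
qed

lemma h1_norm_le_boundary_integral:
  assumes f: "f \<in> h1" and P: "poisson_integral_of_radial_limits f"
  shows "2 * pi * h1_norm f \<le> boundary_integral f"
proof -
  have fc: "continuous_on (ball 0 1) f"
    using f harmonic_on_ball_continuous by (auto simp: h1_def)
  have "h1_norm f \<le> boundary_integral f / (2 * pi)"
    unfolding h1_norm_def
  proof (rule cSUP_least)
    fix r :: real assume "r \<in> {0<..<1}"
    then show "circle_mean f r \<le> boundary_integral f / (2 * pi)"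
      using circle_mean_le_boundary_integral[OF fc P, of r] by (simp add: field_simps)
  qed simp
  then show ?thesis by (simp add: field_simps)
qed

theorem theorem3:
  fixes f :: "complex \<Rightarrow> complex" and \<gamma> :: "real \<Rightarrow> complex" and I :: "real set" and p :: real
  assumes "f \<in> h1"
    and "convex_curve \<gamma> I" and "\<gamma> ` I \<subseteq> ball 0 1"
    and "0 < p" and "p < 1"
  shows "arc_length_integral \<gamma> I (\<lambda>z. norm (f z) powr p)
           \<le> ennreal (A_const p * (2 * pi * h1_norm f) powr p)
       \<and> (poisson_integral_of_radial_limits f \<longrightarrow>
            arc_length_integral \<gamma> I (\<lambda>z. norm (f z) powr p)
              \<le> ennreal (A_const p * boundary_integral f powr p))"
proof -
  have nn: "0 \<le> h1_norm f" by (rule h1_norm_nonneg[OF assms(1)])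
  have main: "arc_length_integral \<gamma> I (\<lambda>z. norm (f z) powr p)
      \<le> ennreal (A_const p * (2 * pi * h1_norm f) powr p)"
    by (rule order_trans[OF convex_curve_integral_le_h1_norm[OF assms]])
      (intro ennreal_leI A_const_bound assms(4,5) nn)
  moreover have "A_const p * (2 * pi * h1_norm f) powr p \<le> A_const p * boundary_integral f powr p"
    if "poisson_integral_of_radial_limits f"
    using h1_norm_le_boundary_integral[OF assms(1) that] nn assms(4,5)
    by (intro mult_left_mono powr_mono2 A_const_nonneg) auto
  ultimately show ?thesis using ennreal_leI order_trans by blast
qed

end
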